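(* Consider the homogeneous single-source $n$-server status-update network (described in the context) with $n\ge 1$, per-server arrival rate $\lambda>0$ and per-server service rate $\mu>0$, and let $\rho=\lambda/\mu$. Then the average age of information at the monitor is $$\Delta=\frac{1}{\mu}\left[\frac{1}{n\rho}\sum_{j=1}^{n-1}\prod_{i=1}^{j}\frac{\rho(n-i+1)}{i+(n-i)\rho}+\frac{1}{n\rho}+\frac{1}{n^2}\prod_{i=1}^{n-1}\frac{\rho(n-i+1)}{i+(n-i)\rho}\right],$$ where an empty sum is $0$ and an empty product is $1$.
   Context: Network model: there are $m$ independent information sources, $n$ servers and one monitor. Updates of source $i$ arrive at server $j$ according to a Poisson process of rate $\lambda_j^{(i)}>0$; all arrival processes are mutually independent. An update's generation time is its arrival time at the server. Each server $j$ sends updates to the monitor over its own link; service times are i.i.d. exponential with rate $\mu_j>0$, independent of everything else. Each server uses last-come-first-serve with preemption in service (LCFS): when a new update (of any source) arrives at a server, the server immediately discards the update it is serving (if any) and starts serving the new one; when a service completes, the update is delivered to the monitor and the server becomes idle until the next arrival. For source $i$, let $u_i(t)$ be the largest generation time among updates of source $i$ delivered to the monitor by time $t$; the age of information is $\Delta_i(t)=t-u_i(t)$ and the average age of information is $\Delta_i=\lim_{T\to\infty}\frac1T\int_0^T\Delta_i(t)\,dt$ (equivalently $\lim_{t\to\infty}\mathbb E[\Delta_i(t)]$). The network is homogeneous if $\lambda_j^{(i)}=\lambda^{(i)}$ and $\mu_j=\mu$ for all $i,j$. In the single-source case ($m=1$) write $\lambda=\lambda^{(1)}$ and $\Delta=\Delta_1$.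 *)

theory Defs
  imports "HOL-Probability.Probability"
begin

text \<open>Sample-path model of the homogeneous single-source n-server LCFS-with-preemption
network.  For server j, A j k is the k-th interarrival time (k = 0,1,...), so the
k-th update arrives (and is generated) at time arr A j k.  Since each server starts
serving an update immediately upon its arrival and preempts it upon the next arrival,
the k-th update at server j receives its own service time S j k and is delivered iff
its service completes before the next arrival at that server.\<close>

definition arr :: "(nat \<Rightarrow> nat \<Rightarrow> real) \<Rightarrow> nat \<Rightarrow> nat \<Rightarrow> real" where
  "arr A j k = (\<Sum>l\<le>k. A j l)"

definition delivered :: "(nat \<Rightarrow> nat \<Rightarrow> real) \<Rightarrow> (nat \<Rightarrow> nat \<Rightarrow> real) \<Rightarrow> nat \<Rightarrow> nat \<Rightarrow> bool" where
  "delivered A S j k \<longleftrightarrow> arr A j k + S j k < arr A j (Suc k)"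

definition latest_gen ::
  "nat \<Rightarrow> (nat \<Rightarrow> nat \<Rightarrow> real) \<Rightarrow> (nat \<Rightarrow> nat \<Rightarrow> real) \<Rightarrow> real \<Rightarrow> real" where
  "latest_gen n A S t = Sup (insert 0 {arr A j k | j k. j < n \<and> delivered A S j k \<and>
                                              arr A j k + S j k \<le> t})"

definition age :: "nat \<Rightarrow> (nat \<Rightarrow> nat \<Rightarrow> real) \<Rightarrow> (nat \<Rightarrow> nat \<Rightarrow> real) \<Rightarrow> real \<Rightarrow> real" where
  "age n A S t = t - latest_gen n A S t"

definition aoi_formula :: "nat \<Rightarrow> real \<Rightarrow> real \<Rightarrow> real" where
  "aoi_formula n lam mu =
     (let \<rho> = lam / mu;
          P = (\<lambda>j. \<Prod>i=1..j. \<rho> * (real n - real i + 1) / (real i + (real n - real i) * \<rho>))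
      in (1 / mu) * ((1 / (real n * \<rho>)) * (\<Sum>j=1..n-1. P j) + 1 / (real n * \<rho>)
                     + (1 / (real n)^2) * P (n - 1)))"

end

(*
  For 0 <= x <= t the age at time t is at least x iff no server completes, by time t, an update
  generated in the window (t - x, t].  On a single server the time until such a completion is
  Exp(lam) + Exp(mu): wait for the first arrival, after which preemption by newer updates does not
  affect the memoryless remaining service.  Hence P(age >= x) = Q x, the n-th power of the tail of
  Exp(lam) + Exp(mu), and for disjoint windows the events are independent.  Both facts come from one
  martingale indexed by the arrivals of a server: the conditional probability, given the past of the
  K-th arrival, that the windows stay free of completions.

  The integral of the age over [0, T] thus has mean c T + O(1), c being the integral of Q, and
  variance O(T).  Chebyshev along T = k^2 and monotonicity in T give almost sure convergence of the
  time average to c.  Finally Q is expanded by the binomial theorem; the terms satisfy a linear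
  chain of differential equations, whose integrals form the products in the formula.
*)
theory Submission
  imports Defs
begin

text \<open>The obstacle is a single server seen through two windows. Its variables do not separate:
  one interarrival time may span both windows, and the fate of an update depends on the next
  arrival. At arrivals the future depends on the current time alone, so both windows are carried
  together, each by a factor \<open>cond_quiet\<close>, and the product weighted by the indicator of
  no violation so far keeps its mean from one arrival to the next. At the start this mean is the
  product of the two tails; once the arrivals have passed the last window the factors are 1, so in
  the limit the mean is the probability of the event. A single window is the case of a second window
  of length 0.

  The integral of the age is written as an area of points \<open>(x, t)\<close>, so its first two
  moments need only the probabilities of one and of two events. Since the latest generation time
  starts at 0, the age never exceeds \<open>t\<close>; the area is cut off accordingly, and this cut
  is the source of the bounded error in the mean.\<close>

section \<open>The tail of a sum of two exponential variables\<close>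

text \<open>A server that has received no update since an instant is still in this state a time
  \<open>x\<close> later with probability \<open>exp (- lam * x)\<close>; \<open>serving lam mu x\<close> is the probability that it has
  then received some update but completed none of the new ones.\<close>

definition serving :: "real \<Rightarrow> real \<Rightarrow> real \<Rightarrow> real" where
  "serving lam mu x = (if lam = mu then lam * x * exp (- lam * x)
     else lam * (exp (- mu * x) - exp (- lam * x)) / (lam - mu))"

definition stale :: "real \<Rightarrow> real \<Rightarrow> real \<Rightarrow> real" where
  "stale lam mu x = exp (- lam * x) + serving lam mu x"

lemma serving_0 [simp]: "serving lam mu 0 = 0"
  by (simp add: serving_def)

lemma stale_0 [simp]: "stale lam mu 0 = 1"
  by (simp add: stale_def)

text \<open>This linear equation covers both branches of the definition, so that the case
  \<open>lam = mu\<close> needs no separate treatment afterwards.\<close>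

lemma DERIV_serving:
  "(serving lam mu has_real_derivative (lam * exp (- lam * x) - mu
      * serving lam mu x)) (at x within S)"
proof (cases "lam = mu")
  case True
  have "((\<lambda>x. mu * x * exp (- mu * x)) has_real_derivative (mu * exp (- mu * x) - mu * (mu * x
      * exp (- mu * x)))) (at x within S)"
    by (auto intro!: derivative_eq_intros simp: algebra_simps)
  moreover have "serving lam mu = (\<lambda>x. mu * x * exp (- mu * x))"
    using True by (auto simp: serving_def)
  ultimately show ?thesis using True by simp
next
  case False
  have "((\<lambda>x. lam * (exp (- mu * x) - exp (- lam * x)) / (lam - mu)) has_real_derivative
      lam * (exp (- mu * x) * (- mu) - exp (- lam * x) * (- lam)) / (lam - mu)) (at x within S)"
    using False by (auto intro!: derivative_eq_intros)
  moreover have "lam * (exp (- mu * x) * (- mu) - exp (- lam * x) * (- lam)) / (lam - mu)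
     = lam * exp (- lam * x) - mu * (lam * (exp (- mu * x) - exp (- lam * x)) / (lam - mu))"
  proof -
    define a b c where "a = exp (- mu * x)" and "b = exp (- lam * x)" and "c = lam - mu"
    have "lam * (a * (- mu) - b * (- lam)) / c = lam * b - mu * (lam * (a - b) / c)"
      using False by (auto simp: c_def divide_simps) (simp add: algebra_simps)
    thus ?thesis by (simp only: a_def b_def c_def)
  qed
  moreover have "serving lam mu = (\<lambda>x. lam * (exp (- mu * x) - exp (- lam * x)) / (lam - mu))"
    using False by (auto simp: serving_def)
  ultimately show ?thesis by simp
qed

lemmas DERIV_serving' [derivative_intros] = DERIV_chain2[OF DERIV_serving]

lemma serving_nonneg:
  assumes "lam > 0" "x \<ge> 0"
  shows "serving lam mu x \<ge> 0"
proof -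
  \<comment> \<open>The integrating factor \<open>exp (mu * x)\<close> cancels the term
    \<open>- mu * serving lam mu x\<close> and leaves a nonnegative derivative.\<close>
  have "exp (mu * 0) * serving lam mu 0 \<le> exp (mu * x) * serving lam mu x"
  proof (rule DERIV_nonneg_imp_nondecreasing[OF assms(2)], goal_cases)
    case (1 y)
    have "((\<lambda>y. exp (mu * y) * serving lam mu y) has_real_derivative exp (mu * y) * (lam
        * exp (- lam * y))) (at y)"
      by (auto intro!: derivative_eq_intros simp: algebra_simps)
    moreover have "exp (mu * y) * (lam * exp (- lam * y)) \<ge> 0" using assms by simp
    ultimately show ?case by blast
  qed
  thus ?thesis by (simp add: zero_le_mult_iff)
qed

text \<open>Multiplying by \<open>exp (m * x)\<close> leaves a derivative of at most
  \<open>lam\<close>. The factor \<open>x\<close> on the right covers equal rates, where the bound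
  is attained for \<open>m = lam\<close>.\<close>

lemma serving_le:
  assumes "lam > 0" "m \<le> lam" "m \<le> mu" "x \<ge> 0"
  shows "serving lam mu x \<le> lam * x * exp (- m * x)"
proof -
  have "lam * 0 - exp (m * 0) * serving lam mu 0 \<le> lam * x - exp (m * x) * serving lam mu x"
  proof (rule DERIV_nonneg_imp_nondecreasing[OF assms(4)], goal_cases)
    case (1 y)
    have "((\<lambda>y. lam * y - exp (m * y) * serving lam mu y) has_real_derivative
        lam * (1 - exp (m * y) * exp (- lam * y)) + (mu - m) * (exp (m * y)
            * serving lam mu y)) (at y)"
      by (auto intro!: derivative_eq_intros simp: algebra_simps)
    moreover have "exp (m * y) * exp (- lam * y) \<le> 1"
      using assms 1 by (simp flip: exp_add add: mult_right_mono)
    moreover have "(mu - m) * (exp (m * y) * serving lam mu y) \<ge> 0"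
      using assms 1 serving_nonneg[of lam y mu] by simp
    ultimately show ?case using assms(1)
      by (intro exI[of _ "lam * (1 - exp (m * y) * exp (- lam * y))
          + (mu - m) * (exp (m * y) * serving lam mu y)"] conjI)
         (auto intro!: add_nonneg_nonneg)
  qed
  hence "exp (m * x) * serving lam mu x \<le> lam * x" by simp
  hence "exp (- m * x) * (exp (m * x) * serving lam mu x) \<le> exp (- m * x) * (lam * x)"
    by (intro mult_left_mono) auto
  moreover have "exp (- m * x) * (exp (m * x) * serving lam mu x) = serving lam mu x"
    by (simp flip: mult.assoc exp_add)
  ultimately have "serving lam mu x \<le> exp (- m * x) * (lam * x)" by (simp only:)
  thus ?thesis by (simp only: mult_ac)
qed

lemma stale_nonneg: "lam > 0 \<Longrightarrow> x \<ge> 0 \<Longrightarrow> stale lam mu x \<ge> 0"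
  by (simp add: stale_def serving_nonneg)

text \<open>Half of the smaller rate \<open>m\<close> pays for the factor \<open>x\<close>:
  \<open>m / 2 * x * exp (- (m / 2) * x)\<close> is at most 1, which yields the constant
  \<open>2 * lam / m\<close>.\<close>

lemma stale_exp_bound:
  assumes "lam > 0" "mu > 0"
  obtains C g where "C > 0" "g > 0" "\<And>x. x \<ge> 0 \<Longrightarrow> stale lam mu x \<le> C * exp (- g * x)"
proof -
  define m where "m = min lam mu"
  have m: "m > 0" "m \<le> lam" "m \<le> mu" using assms by (auto simp: m_def)
  have "stale lam mu x \<le> (1 + 2 * lam / m) * exp (- (m / 2) * x)" if x: "x \<ge> 0" for x
  proof -
    have "exp (- lam * x) \<le> exp (- (m / 2) * x)"
      using m x mult_right_mono[of "m / 2" lam x] by simp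
    moreover have "serving lam mu x \<le> 2 * lam / m * exp (- (m / 2) * x)"
    proof -
      have "serving lam mu x \<le> lam * x * exp (- m * x)" using serving_le[OF assms(1) m(2,3) x] .
      also have "exp (- m * x) = exp (- (m / 2) * x) * exp (- (m / 2) * x)"
        by (simp flip: exp_add)
      also have "lam * x * (exp (- (m / 2) * x) * exp (- (m / 2) * x))
          = 2 * lam / m * exp (- (m / 2) * x) * (m / 2 * x * exp (- (m / 2) * x))"
        using m by (simp add: field_simps)
      also have "\<dots> \<le> 2 * lam / m * exp (- (m / 2) * x) * 1"
      proof (rule mult_left_mono)
        have "m / 2 * x \<le> exp (m / 2 * x)" using exp_ge_add_one_self[of "m/2*x"] by linarith
        thus "m / 2 * x * exp (- (m / 2) * x) \<le> 1" by (simp add: exp_minus field_simps)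
      qed (use m assms in simp)
      finally show ?thesis by simp
    qed
    ultimately show ?thesis unfolding stale_def distrib_right mult_1 by (rule add_mono)
  qed
  thus ?thesis using m assms by (intro that[of "1 + 2 * lam / m" "m / 2"]) (auto intro: add_pos_pos)
qed

lemma continuous_on_serving [continuous_intros]:
  "continuous_on A f \<Longrightarrow> continuous_on A (\<lambda>x. serving lam mu (f x))"
  by (rule continuous_on_compose2[OF DERIV_continuous_on[OF DERIV_serving, of UNIV]]) auto

lemma continuous_on_stale [continuous_intros]:
  "continuous_on A f \<Longrightarrow> continuous_on A (\<lambda>x. stale lam mu (f x))"
  unfolding stale_def by (intro continuous_intros)

lemma measurable_stale [measurable]: "stale lam mu \<in> borel_measurable borel"
  by (intro borel_measurable_continuous_onI continuous_intros)

lemma stale_tendsto_0: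
  assumes "lam > 0" "mu > 0"
  shows "(stale lam mu \<longlongrightarrow> 0) at_top"
proof -
  obtain C g where *: "C > 0" "g > 0" "\<And>x. x \<ge> 0 \<Longrightarrow> stale lam mu x \<le> C * exp (- g * x)"
    using stale_exp_bound[OF assms] by metis
  have "((\<lambda>x. C * exp (- g * x)) \<longlongrightarrow> 0) at_top"
    using * by (intro tendsto_mult_right_zero filterlim_compose[OF exp_at_bot]
        filterlim_tendsto_neg_mult_at_bot[OF tendsto_const]) (auto simp: filterlim_ident)
  moreover have "eventually (\<lambda>x. 0 \<le> stale lam mu x \<and> stale lam mu x \<le> C * exp (- g * x)) at_top"
    using eventually_ge_at_top[of 0] by eventually_elim (use * assms stale_nonneg in auto)
  ultimately show ?thesis
    by (auto intro: tendsto_sandwich[OF _ _ tendsto_const[of 0]] elim: eventually_mono)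
qed

section \<open>Expansion over the number of busy servers, and its integrals\<close>

text \<open>The probability that exactly \<open>k\<close> of \<open>n\<close> servers are serving a new update and none has
  completed one.\<close>

definition binterm :: "nat \<Rightarrow> real \<Rightarrow> real \<Rightarrow> nat \<Rightarrow> real \<Rightarrow> real" where
  "binterm n lam mu k x = real (n choose k) * exp (- lam * x) ^ (n - k) * serving lam mu x ^ k"

lemma stale_power_eq: "stale lam mu x ^ n = (\<Sum>k\<le>n. binterm n lam mu k x)"
  unfolding stale_def binterm_def
  by (subst add.commute, subst binomial_ring) (simp add: mult_ac)

lemma DERIV_binterm_0:
  "(binterm n lam mu 0 has_real_derivative - (real n * lam) * binterm n lam mu 0 x) (at x within S)"
proof -
  have eq: "binterm n lam mu 0 = (\<lambda>x. exp (- (real n * lam) * x))"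
    by (auto simp: binterm_def exp_of_nat_mult[symmetric] mult_ac fun_eq_iff)
  show ?thesis unfolding eq by (auto intro!: derivative_eq_intros)
qed

text \<open>Forward equation of a birth chain with killing: with \<open>k\<close> servers busy on
  new updates, one of the other \<open>n - k\<close> receives an update at rate
  \<open>lam * (n - k)\<close>, and a completion, at rate \<open>k * mu\<close>, ends the
  event.\<close>

lemma DERIV_binterm_Suc:
  assumes "k < n"
  shows "(binterm n lam mu (Suc k) has_real_derivative
     lam * real (n - k) * binterm n lam mu k x
     - (real (n - Suc k) * lam + real (Suc k) * mu) * binterm n lam mu (Suc k) x) (at x within S)"
proof -
  define d where "d = n - Suc k"
  have n: "n - k = Suc d" "n - Suc k = d" using assms by (auto simp: d_def)
  \<comment> \<open>The absorption identity turns the gain term, which carries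
    \<open>n choose Suc k\<close>, into a multiple of \<open>binterm n lam mu k x\<close>.\<close>
  have ch: "real (Suc k) * real (n choose Suc k) = real (Suc d) * real (n choose k)"
    using binomial_absorb_comp[of n k] Suc_times_binomial_eq[of "n-1" k] assms n
    by (metis Suc_times_binomial_add add_Suc_right add_Suc_shift binomial_symmetric d_def
        le_add_diff_inverse less_or_eq_imp_le of_nat_mult Suc_leI diff_add_inverse2)
  define e where "e = exp (- lam * x)"
  define p where "p = serving lam mu x"
  have eq: "binterm n lam mu (Suc k) = (\<lambda>x. real (n choose Suc k) * exp (- (real d * lam) * x)
      * serving lam mu x ^ Suc k)"
    by (auto simp: binterm_def exp_of_nat_mult[symmetric] mult_ac fun_eq_iff n)
  have ee: "exp (- (real d * lam) * x) = e ^ d" unfolding e_def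
    by (auto simp: exp_of_nat_mult[symmetric] mult_ac)
  have "((\<lambda>x. real (n choose Suc k) * exp (- (real d * lam) * x)
      * serving lam mu x ^ Suc k) has_real_derivative
     real (n choose Suc k) * (e ^ d * (- (real d * lam)) * p ^ Suc k
       + e ^ d * (real (Suc k) * p ^ k * (lam * e - mu * p)))) (at x within S)"
  proof -
    have d1: "((\<lambda>x. exp (- (real d * lam) * x)) has_real_derivative e ^ d * (- (real d
        * lam))) (at x within S)"
      unfolding ee[symmetric] by (auto intro!: derivative_eq_intros)
    have d2: "((\<lambda>x. serving lam mu x ^ Suc k) has_real_derivative real (Suc k) * p ^ k * (lam
        * e - mu * p)) (at x within S)"
      using DERIV_power[OF DERIV_serving[of lam mu x S], of "Suc k"]
          by (simp add: e_def p_def mult_ac)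
    show ?thesis
      using DERIV_cmult[OF DERIV_mult[OF d1 d2], of "real (n choose Suc k)"]
      by (simp only: ee p_def[symmetric]) (simp add: algebra_simps)
  qed
  also have "real (n choose Suc k) * (e ^ d * (- (real d * lam)) * p ^ Suc k
       + e ^ d * (real (Suc k) * p ^ k * (lam * e - mu * p)))
     = lam * (real (Suc k) * real (n choose Suc k)) * (e ^ Suc d * p ^ k)
       - (real d * lam + real (Suc k) * mu) * (real (n choose Suc k) * e ^ d * p ^ Suc k)"
    by (simp add: algebra_simps)
  finally show ?thesis
    unfolding ch by (simp only: eq[symmetric]) (simp add: binterm_def n e_def p_def mult_ac)
qed

lemma continuous_on_binterm: "continuous_on A (binterm n lam mu k)"
  unfolding binterm_def by (intro continuous_intros)

lemma binterm_tendsto_0: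
  assumes "lam > 0" "mu > 0" "n > 0" "k \<le> n"
  shows "(binterm n lam mu k \<longlongrightarrow> 0) at_top"
proof -
  have "((\<lambda>x. stale lam mu x ^ n) \<longlongrightarrow> 0 ^ n) at_top"
    by (intro tendsto_intros stale_tendsto_0 assms)
  hence lim: "((\<lambda>x. stale lam mu x ^ n) \<longlongrightarrow> 0) at_top" using assms by (simp add: power_0_left)
  have "eventually (\<lambda>x. 0 \<le> binterm n lam mu k x \<and> binterm n lam mu k x \<le>
      stale lam mu x ^ n) at_top"
    using eventually_ge_at_top[of 0]
  proof eventually_elim
    case (elim x)
    have nn: "binterm n lam mu k x \<ge> 0" for k
      using serving_nonneg[of lam x mu] elim assms by (simp add: binterm_def)
    thus ?case unfolding stale_power_eq using assms(4) by (auto intro!: member_le_sum)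
  qed
  thus ?thesis using lim
    by (auto intro: tendsto_sandwich[OF _ _ tendsto_const[of 0] lim] elim: eventually_mono)
qed

text \<open>Integrate the forward equation over the half-line: for \<open>Suc k\<close> the term
  vanishes at both ends, so inflow equals outflow, and the integral is that for \<open>k\<close>
  times the ratio of the two rates. The factor in front is the integral for \<open>k = 0\<close>,
  that of \<open>exp (- n * lam * x)\<close>.\<close>

lemma integral_binterm_tendsto:
  assumes "lam > 0" "mu > 0" "n > 0" "k \<le> n"
  shows "((\<lambda>T. integral {0..T} (binterm n lam mu k)) \<longlongrightarrow>
     1 / (real n * lam) * (\<Prod>i=1..k. lam * (real n - real i + 1) / (real i * mu
         + (real n - real i) * lam))) at_top"
  using assms(4)
proof (induction k)
  case 0
  have ev: "eventually (\<lambda>T. integral {0..T} (binterm n lam mu 0) =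
      (1 - binterm n lam mu 0 T) / (real n * lam)) at_top"
    using eventually_ge_at_top[of 0]
  proof eventually_elim
    case (elim T)
    have "((\<lambda>x. - (real n * lam) * binterm n lam mu 0 x) has_integral binterm n lam mu 0 T -
        binterm n lam mu 0 0) {0..T}"
      using elim by (intro fundamental_theorem_of_calculus)
        (auto simp flip: has_real_derivative_iff_has_vector_derivative intro!:
            DERIV_binterm_0[simplified])
    hence "integral {0..T} (\<lambda>x. - (real n * lam) * binterm n lam mu 0 x) =
        binterm n lam mu 0 T - binterm n lam mu 0 0"
      by (rule integral_unique)
    hence "- (real n * lam) * integral {0..T} (binterm n lam mu 0) =
        binterm n lam mu 0 T - binterm n lam mu 0 0"
      by simp
    thus ?case using assms by (simp add: field_simps binterm_def)
  qed
  have "((\<lambda>T. (1 - binterm n lam mu 0 T) / (real n * lam)) \<longlongrightarrow> (1 - 0) / (real n * lam)) at_top"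
    by (intro tendsto_intros binterm_tendsto_0) (use assms in auto)
  thus ?case using tendsto_cong[OF ev] by simp
next
  case (Suc k)
  define al where "al = real (n - Suc k) * lam + real (Suc k) * mu"
  have al: "al > 0" using assms by (auto simp: al_def intro!: add_nonneg_pos)
  have ev: "eventually (\<lambda>T. integral {0..T} (binterm n lam mu (Suc k)) =
     (lam * real (n - k) * integral {0..T} (binterm n lam mu k) - binterm n lam mu
         (Suc k) T) / al) at_top"
    using eventually_ge_at_top[of 0]
  proof eventually_elim
    case (elim T)
    have int: "binterm n lam mu k integrable_on {0..T}" for k
      by (intro integrable_continuous_interval continuous_on_binterm)
    have "((\<lambda>x. lam * real (n - k) * binterm n lam mu k x - al
        * binterm n lam mu (Suc k) x) has_integral
        binterm n lam mu (Suc k) T - binterm n lam mu (Suc k) 0) {0..T}"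
      unfolding al_def using elim Suc.prems by (intro fundamental_theorem_of_calculus)
        (auto simp del: of_nat_Suc of_nat_diff simp flip:
            has_real_derivative_iff_has_vector_derivative intro!: DERIV_binterm_Suc)
    moreover have "((\<lambda>x. lam * real (n - k) * binterm n lam mu k x - al
        * binterm n lam mu (Suc k) x) has_integral
        lam * real (n - k) * integral {0..T} (binterm n lam mu k) - al
            * integral {0..T} (binterm n lam mu (Suc k))) {0..T}"
      by (intro has_integral_diff has_integral_mult_right integrable_integral int)
    ultimately have "binterm n lam mu (Suc k) T - binterm n lam mu (Suc k) 0 =
        lam * real (n - k) * integral {0..T} (binterm n lam mu k) - al
            * integral {0..T} (binterm n lam mu (Suc k))"
      by (rule has_integral_unique)
    moreover have "binterm n lam mu (Suc k) 0 = 0" by (simp add: binterm_def)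
    ultimately show ?case using al by (simp add: field_simps)
  qed
  define J where "J = 1 / (real n * lam) * (\<Prod>i=1..k. lam * (real n - real i + 1) / (real i * mu
      + (real n - real i) * lam))"
  have "((\<lambda>T. (lam * real (n - k) * integral {0..T} (binterm n lam mu k) - binterm n lam mu
      (Suc k) T) / al)
     \<longlongrightarrow> (lam * real (n - k) * J - 0) / al) at_top"
    unfolding J_def using Suc al assms
    by (intro tendsto_intros binterm_tendsto_0 Suc.IH) auto
  also have "(lam * real (n - k) * J - 0) / al = J * (lam * (real n - real (Suc k)
      + 1) / (real (Suc k) * mu + (real n - real (Suc k)) * lam))"
    using Suc.prems by (simp add: al_def of_nat_diff add.commute)
  also have "\<dots> = 1 / (real n * lam) * (\<Prod>i=1..Suc k. lam * (real n - real i + 1) / (real i * mu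
      + (real n - real i) * lam))"
    by (simp add: J_def)
  finally show ?case using tendsto_cong[OF ev] by simp
qed

lemma integral_stale_power_tendsto:
  assumes "lam > 0" "mu > 0" "n > 0"
  shows "((\<lambda>T. integral {0..T} (\<lambda>x. stale lam mu x ^ n)) \<longlongrightarrow> aoi_formula n lam mu) at_top"
proof -
  define f where "f i = lam * (real n - real i + 1) / (real i * mu
      + (real n - real i) * lam)" for i :: nat
  define P where "P k = (\<Prod>i=1..k. f i)" for k
  have int: "binterm n lam mu k integrable_on {0..T}" for k T
    by (intro integrable_continuous_interval continuous_on_binterm)
  have "((\<lambda>T. \<Sum>k\<le>n. integral {0..T} (binterm n lam mu k)) \<longlongrightarrow> (\<Sum>k\<le>n. 1 / (real n * lam)
      * P k)) at_top"
    unfolding P_def f_def by (intro tendsto_sum integral_binterm_tendsto assms) auto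
  moreover have "(\<Sum>k\<le>n. integral {0..T} (binterm n lam mu k)) =
      integral {0..T} (\<lambda>x. stale lam mu x ^ n)" for T
    unfolding stale_power_eq by (rule integral_sum[symmetric]) (auto intro: int)
  moreover have "(\<Sum>k\<le>n. 1 / (real n * lam) * P k) = aoi_formula n lam mu"
  proof -
    have f_eq: "lam / mu * (real n - real i + 1) / (real i + (real n - real i) * (lam / mu)) = f i"
      for i
    proof -
      have "lam / mu * (real n - real i + 1) / (real i + (real n - real i) * (lam / mu)) =
        (lam * (real n - real i + 1) / mu) / ((real i * mu + (real n - real i) * lam) / mu)"
        using assms by (simp add: field_simps)
      also have "\<dots> = f i" using assms by (simp add: f_def)
      finally show ?thesis .
    qed
    have "{..n} = insert 0 (insert n {1..n-1})" using assms by auto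
    hence "(\<Sum>k\<le>n. P k) = P 0 + P n + (\<Sum>k=1..n-1. P k)" using assms by simp
    moreover have "P 0 = 1" by (simp add: P_def)
    \<comment> \<open>At \<open>i = n\<close> the summand with \<open>lam\<close> drops out of the
      denominator; times \<open>1 / (n * lam)\<close> this last factor gives the
      \<open>1 / (n^2 * mu)\<close> in front of the final product.\<close>
    moreover have "P n = P (n - 1) * (lam / (n * mu))"
      using assms by (cases n) (simp_all add: P_def f_def)
    ultimately have "1 / (real n * lam) * (\<Sum>k\<le>n. P k) =
       1 / (real n * lam) * (\<Sum>k=1..n-1. P k) + 1 / (real n * lam) + 1 / (n^2 * mu) * P (n - 1)"
      using assms by (simp add: field_simps power2_eq_square)
    thus ?thesis unfolding aoi_formula_def Let_def f_eq P_def[symmetric]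
      using assms by (simp only: sum_distrib_left[symmetric]) (simp add: field_simps)
  qed
  ultimately show ?thesis by simp
qed

lemma nn_integral_stale_power:
  assumes "lam > 0" "mu > 0" "n > 0"
  shows "(\<integral>\<^sup>+x. ennreal (stale lam mu x ^ n) * indicator {0..} x \<partial>lborel) =
      ennreal (aoi_formula n lam mu)"
proof -
  define f where "f x = stale lam mu x ^ n" for x
  \<comment> \<open>The base point -1 makes 0 an interior point, so that \<open>F\<close> has a
    two-sided derivative there.\<close>
  define F where "F T = integral {-1..T} f - integral {-1..0} f" for T
  have cont: "continuous_on A f" for A
    unfolding f_def by (intro continuous_intros)
  have ev: "eventually (\<lambda>T. integral {0..T} f = F T) at_top"
    using eventually_ge_at_top[of 0]
  proof eventually_elim
    case (elim T)
    show ?case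
      using Henstock_Kurzweil_Integration.integral_combine[of "-1" 0 T f] elim
      by (simp add: F_def integrable_continuous_interval cont)
  qed
  have "(\<integral>\<^sup>+x. ennreal (f x) * indicator {0..} x \<partial>lborel) = ennreal (aoi_formula n lam mu - F 0)"
  proof (rule nn_integral_FTC_atLeast)
    show "(F \<longlongrightarrow> aoi_formula n lam mu) at_top"
      using integral_stale_power_tendsto[OF assms, folded f_def] tendsto_cong[OF ev] by simp
    show "0 \<le> f x" if "0 \<le> x" for x
      using stale_nonneg[OF assms(1) that] by (simp add: f_def)
    show "(F has_real_derivative f x) (at x)" if "0 \<le> x" for x
    proof -
      have "((\<lambda>u. integral {-1..u} f) has_real_derivative f x) (at x within {-1..x+1})"
        by (rule integral_has_real_derivative[OF cont]) (use that in auto)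
      hence "((\<lambda>u. integral {-1..u} f) has_real_derivative f x) (at x)"
        using that by (simp add: at_within_Icc_at)
      thus ?thesis unfolding F_def by (auto intro!: derivative_eq_intros)
    qed
    show "f \<in> borel_measurable borel" unfolding f_def by measurable
  qed
  thus ?thesis by (simp add: F_def f_def)
qed

section \<open>Time averages of processes with finite memory\<close>

lemma nn_integral_exp_bound_finite:
  fixes f :: "real \<Rightarrow> real"
  assumes "g > 0" "\<And>x. x \<ge> 0 \<Longrightarrow> f x \<le> C * exp (- g * x)" "C \<ge> 0"
  shows "(\<integral>\<^sup>+x. ennreal (f x) * indicator {0..} x \<partial>lborel) < \<infinity>"
proof -
  have lim: "((\<lambda>x. - (C / g) * exp (- g * x)) \<longlongrightarrow> 0) at_top"
    using assms by (intro tendsto_mult_right_zero filterlim_compose[OF exp_at_bot]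
        filterlim_tendsto_neg_mult_at_bot[OF tendsto_const]) (auto simp: filterlim_ident)
  have "(\<integral>\<^sup>+x. ennreal (f x) * indicator {0..} x \<partial>lborel) \<le>
     (\<integral>\<^sup>+x. ennreal (C * exp (- g * x)) * indicator {0..} x \<partial>lborel)"
    using assms by (intro nn_integral_mono) (auto split: split_indicator intro!: ennreal_leI)
  also have "\<dots> = ennreal (0 - (- (C / g) * exp (- g * 0)))"
    using assms lim by (intro nn_integral_FTC_atLeast) (auto intro!: derivative_eq_intros)
  also have "\<dots> < \<infinity>" by simp
  finally show ?thesis .
qed

lemma nn_integral_mult_exp_bound_finite:
  fixes f :: "real \<Rightarrow> real"
  assumes "g > 0" "\<And>x. x \<ge> 0 \<Longrightarrow> f x \<le> C * exp (- g * x)" "C \<ge> 0"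
  shows "(\<integral>\<^sup>+x. ennreal (x * f x) * indicator {0..} x \<partial>lborel) < \<infinity>"
proof (rule nn_integral_exp_bound_finite)
  show "g / 2 > 0" "C * (2 / g) \<ge> 0" using assms by auto
  show "x * f x \<le> C * (2 / g) * exp (- (g / 2) * x)" if "x \<ge> 0" for x
  proof -
    have "g / 2 * x \<le> exp (g / 2 * x)" using exp_ge_add_one_self[of "g/2*x"] by linarith
    hence "x \<le> 2 / g * exp (g / 2 * x)" using assms by (simp add: field_simps)
    have "x * f x \<le> x * (C * exp (- g * x))"
      using assms(2)[OF that] that by (intro mult_left_mono)
    also have "\<dots> \<le> 2 / g * exp (g / 2 * x) * (C * exp (- g * x))"
      using \<open>x \<le> 2 / g * exp (g / 2 * x)\<close> assms by (intro mult_right_mono) auto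
    also have "\<dots> = C * (2 / g) * (exp (g / 2 * x) * exp (- g * x))" by simp
    also have "exp (g / 2 * x) * exp (- g * x) = exp (- (g / 2) * x)"
      by (simp flip: exp_add add: field_simps)
    finally show ?thesis .
  qed
qed

lemma nn_integral_square:
  assumes "sigma_finite_measure W" "prob_space M"
    and [measurable]: "case_prod f \<in> borel_measurable (W \<Otimes>\<^sub>M M)"
  shows "(\<integral>\<^sup>+\<omega>. (\<integral>\<^sup>+p. f p \<omega> \<partial>W)\<^sup>2 \<partial>M) = (\<integral>\<^sup>+p. \<integral>\<^sup>+p'. \<integral>\<^sup>+\<omega>. f p \<omega> * f p' \<omega> \<partial>M \<partial>W \<partial>W)"
proof -
  interpret prob_space M by fact
  interpret W: sigma_finite_measure W by fact
  interpret WM: pair_sigma_finite W M ..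
  have "(\<integral>\<^sup>+\<omega>. (\<integral>\<^sup>+p. f p \<omega> \<partial>W)\<^sup>2 \<partial>M) = (\<integral>\<^sup>+\<omega>. \<integral>\<^sup>+p. \<integral>\<^sup>+p'. f p \<omega> * f p' \<omega> \<partial>W \<partial>W \<partial>M)"
    by (intro nn_integral_cong) (simp add: power2_eq_square nn_integral_cmult nn_integral_multc)
  also have "\<dots> = (\<integral>\<^sup>+p. \<integral>\<^sup>+\<omega>. \<integral>\<^sup>+p'. f p \<omega> * f p' \<omega> \<partial>W \<partial>M \<partial>W)"
    by (rule WM.Fubini') measurable
  also have "\<dots> = (\<integral>\<^sup>+p. \<integral>\<^sup>+p'. \<integral>\<^sup>+\<omega>. f p \<omega> * f p' \<omega> \<partial>M \<partial>W \<partial>W)"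
    by (intro nn_integral_cong WM.Fubini') measurable
  finally show ?thesis .
qed

definition region :: "(real \<Rightarrow> real \<Rightarrow> 'w \<Rightarrow> bool) \<Rightarrow> real \<Rightarrow> 'w \<Rightarrow> (real \<times> real) set" where
  "region B T \<omega> = {(x, t). 0 \<le> x \<and> x \<le> t \<and> t \<le> T \<and> B x t \<omega>}"

text \<open>\<open>B x t\<close> stands for the event that a process has value at least \<open>x\<close> at time \<open>t\<close>, and is
  determined by the time interval from \<open>t - x\<close> to \<open>t\<close>. The area of \<open>region B T \<omega>\<close> is then the
  integral of the process over \<open>{0..T}\<close>.\<close>

locale finite_memory = prob_space M for M :: "'w measure" +
  fixes B :: "real \<Rightarrow> real \<Rightarrow> 'w \<Rightarrow> bool" and Q :: "real \<Rightarrow> real" and C g c :: real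
  assumes measurable_B [measurable]: "Measurable.pred (borel \<Otimes>\<^sub>M borel \<Otimes>\<^sub>M M) (\<lambda>(x, t, \<omega>). B x t \<omega>)"
    and measurable_Q [measurable]: "Q \<in> borel_measurable borel"
    and C: "C \<ge> 0" and g: "g > 0" and c: "c \<ge> 0"
    and Q_nonneg: "\<And>x. 0 \<le> x \<Longrightarrow> 0 \<le> Q x"
    and Q_le: "\<And>x. 0 \<le> x \<Longrightarrow> Q x \<le> C * exp (- g * x)"
    and prob1: "\<And>x t. 0 \<le> x \<Longrightarrow> x \<le> t \<Longrightarrow> prob {\<omega>\<in>space M. B x t \<omega>} = Q x"
    and prob2: "\<And>x y s t. 0 \<le> x \<Longrightarrow> 0 \<le> y \<Longrightarrow> y \<le> s \<Longrightarrow> s \<le> t - x \<Longrightarrow>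
        prob {\<omega>\<in>space M. B x t \<omega> \<and> B y s \<omega>} = Q x * Q y"
    and nn_integral_Q: "(\<integral>\<^sup>+x. ennreal (Q x) * indicator {0..} x \<partial>lborel) = ennreal c"
begin

abbreviation "W \<equiv> (lborel \<Otimes>\<^sub>M lborel :: (real \<times> real) measure)"

definition vol :: "real \<Rightarrow> 'w \<Rightarrow> ennreal" where
  "vol T \<omega> = emeasure W (region B T \<omega>)"

definition ind :: "real \<Rightarrow> real \<times> real \<Rightarrow> 'w \<Rightarrow> ennreal" where
  "ind T p \<omega> = indicator (region B T \<omega>) p"

lemma measurable_ind [measurable]: "case_prod (ind T) \<in> borel_measurable (W \<Otimes>\<^sub>M M)"
proof -
  have [measurable]: "(\<lambda>z. (fst (fst z), snd (fst z), snd z)) \<in> W \<Otimes>\<^sub>M M \<rightarrow>\<^sub>M borel \<Otimes>\<^sub>M borel \<Otimes>\<^sub>M M"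
    by measurable
  have [measurable]: "Measurable.pred (W \<Otimes>\<^sub>M M) (\<lambda>z. B (fst (fst z)) (snd (fst z)) (snd z))"
    using measurable_compose[OF \<open>(\<lambda>z. (fst (fst z), snd (fst z), snd z))
        \<in> W \<Otimes>\<^sub>M M \<rightarrow>\<^sub>M borel \<Otimes>\<^sub>M borel \<Otimes>\<^sub>M M\<close> measurable_B]
    by simp
  have "case_prod (ind T) = (\<lambda>z. if 0 \<le> fst (fst z) \<and> fst (fst z) \<le> snd (fst z) \<and> snd (fst z) \<le> T
     \<and> B (fst (fst z)) (snd (fst z)) (snd z) then 1 else 0)"
    by (auto simp: ind_def region_def fun_eq_iff split: split_indicator)
  also have "\<dots> \<in> borel_measurable (W \<Otimes>\<^sub>M M)" by measurable
  finally show ?thesis .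
qed

lemma sigma_finite_W: "sigma_finite_measure W"
  by (simp add: lborel_prod sigma_finite_lborel)

lemma events_B [measurable]: "{\<omega>\<in>space M. B x t \<omega>} \<in> events"
proof -
  have "(\<lambda>\<omega>. (x, t, \<omega>)) \<in> M \<rightarrow>\<^sub>M borel \<Otimes>\<^sub>M borel \<Otimes>\<^sub>M M" by measurable
  from measurable_compose[OF this measurable_B] show ?thesis by simp
qed

lemma sets_region [measurable]:
  assumes "\<omega> \<in> space M"
  shows "region B T \<omega> \<in> sets W"
proof -
  have "(\<lambda>p. ind T p \<omega>) \<in> borel_measurable W"
    using assms by measurable
  hence "(\<lambda>p. ind T p \<omega>) -` {1} \<inter> space W \<in> sets W" by (rule measurable_sets) auto
  also have "(\<lambda>p. ind T p \<omega>) -` {1} \<inter> space W = region B T \<omega>"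
    by (auto simp: ind_def space_pair_measure split: split_indicator_asm)
  finally show ?thesis .
qed

lemma vol_eq: "\<omega> \<in> space M \<Longrightarrow> vol T \<omega> = (\<integral>\<^sup>+p. ind T p \<omega> \<partial>W)"
  unfolding vol_def ind_def by (rule nn_integral_indicator[symmetric]) (rule sets_region)

lemma measurable_vol [measurable]: "vol T \<in> borel_measurable M"
proof -
  interpret W: sigma_finite_measure W by (rule sigma_finite_W)
  have "(\<lambda>\<omega>. \<integral>\<^sup>+p. ind T p \<omega> \<partial>W) \<in> borel_measurable M" by measurable
  thus ?thesis by (subst measurable_cong[OF vol_eq])
qed

lemma vol_le:
  assumes "T \<ge> 0"
  shows "vol T \<omega> \<le> ennreal (T * T)"
proof -
  have "vol T \<omega> \<le> emeasure W ({0..T} \<times> {0..T})"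
    unfolding vol_def by (intro emeasure_mono) (auto simp: region_def)
  also have "\<dots> = ennreal (T * T)"
    using assms by (subst lborel.emeasure_pair_measure_Times) (auto simp: ennreal_mult)
  finally show ?thesis .
qed

text \<open>For fixed \<open>x\<close> the times \<open>t\<close> range over \<open>{x..T}\<close>.
  The conversion to \<open>ennreal\<close> truncates \<open>T - x\<close> at 0, so the formula also
  covers \<open>x > T\<close>.\<close>

lemma nn_integral_vol:
  assumes "T \<ge> 0"
  shows "(\<integral>\<^sup>+\<omega>. vol T \<omega> \<partial>M) = (\<integral>\<^sup>+x. ennreal (Q x) * ennreal (T - x) * indicator {0..} x \<partial>lborel)"
proof -
  interpret W: sigma_finite_measure W by (rule sigma_finite_W)
  interpret WM: pair_sigma_finite W M ..
  have "(\<integral>\<^sup>+\<omega>. vol T \<omega> \<partial>M) = (\<integral>\<^sup>+\<omega>. \<integral>\<^sup>+p. ind T p \<omega> \<partial>W \<partial>M)"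
    by (intro nn_integral_cong vol_eq)
  also have "\<dots> = (\<integral>\<^sup>+p. \<integral>\<^sup>+\<omega>. ind T p \<omega> \<partial>M \<partial>W)"
    by (intro WM.Fubini') measurable
  also have "\<dots> = (\<integral>\<^sup>+p. ennreal (Q (fst p)) * indicator {(x, t). 0 \<le> x \<and> x \<le> t \<and> t \<le> T} p \<partial>W)"
  proof (intro nn_integral_cong)
    fix p :: "real \<times> real"
    obtain x t where p: "p = (x, t)" by (cases p)
    show "(\<integral>\<^sup>+\<omega>. ind T p \<omega> \<partial>M) = ennreal (Q (fst p)) * indicator {(x, t). 0 \<le> x \<and> x \<le> t \<and> t \<le> T} p"
    proof (cases "0 \<le> x \<and> x \<le> t \<and> t \<le> T")
      case True
      have "(\<integral>\<^sup>+\<omega>. ind T p \<omega> \<partial>M) = (\<integral>\<^sup>+\<omega>. indicator {\<omega>\<in>space M. B x t \<omega>} \<omega> \<partial>M)"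
        using True by (intro nn_integral_cong) (auto simp: ind_def region_def p split:
            split_indicator)
      also have "\<dots> = ennreal (Q x)" using True by (simp add: emeasure_eq_measure prob1)
      finally show ?thesis using True by (simp add: p)
    next
      case False
      hence "ind T p \<omega> = 0" for \<omega> by (auto simp: ind_def region_def p)
      thus ?thesis using False by (auto simp: p)
    qed
  qed
  also have "\<dots> = (\<integral>\<^sup>+x. \<integral>\<^sup>+t. ennreal (Q x) * indicator {(x, t). 0 \<le> x \<and> x \<le> t \<and> t \<le>
      T} (x, t) \<partial>lborel \<partial>lborel)"
    by (subst lborel.nn_integral_fst[symmetric]) simp_all
  also have "\<dots> = (\<integral>\<^sup>+x. \<integral>\<^sup>+t. ennreal (Q x) * indicator {0..} x
      * indicator {x..T} t \<partial>lborel \<partial>lborel)"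
    by (intro nn_integral_cong) (auto split: split_indicator)
  also have "\<dots> = (\<integral>\<^sup>+x. ennreal (Q x) * ennreal (T - x) * indicator {0..} x \<partial>lborel)"
    by (intro nn_integral_cong) (auto simp: nn_integral_cmult mult_ac max_def
        emeasure_lborel_Icc_eq ennreal_neg split: split_indicator)
  finally show ?thesis .
qed

text \<open>The points with \<open>x > t\<close> are missing from the region; their loss is at most
  the integral of \<open>x * Q x\<close>, whatever \<open>T\<close>. A lower bound is enough, as the
  mean enters the variance estimate with a negative sign.\<close>

lemma first_moment:
  obtains c1 where "c1 \<ge> 0" "\<And>T. T \<ge> 0 \<Longrightarrow> ennreal (c * T) \<le> (\<integral>\<^sup>+\<omega>. vol T \<omega> \<partial>M) + ennreal c1"
proof -
  have fin: "(\<integral>\<^sup>+x. ennreal (x * Q x) * indicator {0..} x \<partial>lborel) < \<infinity>" (is "?c < _")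
    by (rule nn_integral_mult_exp_bound_finite[OF g Q_le C])
  have "ennreal (c * T) \<le> (\<integral>\<^sup>+\<omega>. vol T \<omega> \<partial>M) + ennreal (enn2real ?c)" if "T \<ge> 0" for T
  proof -
    have "ennreal (c * T) = (\<integral>\<^sup>+x. ennreal (Q x) * indicator {0..} x * ennreal T \<partial>lborel)"
      using that c by (subst nn_integral_multc) (auto simp: nn_integral_Q ennreal_mult)
    also have "\<dots> \<le> (\<integral>\<^sup>+x. ennreal (Q x) * ennreal (T - x) * indicator {0..} x
        + ennreal (x * Q x) * indicator {0..} x \<partial>lborel)"
    proof (intro nn_integral_mono)
      fix x :: real
      have "Q x * T \<le> Q x * max 0 (T - x) + x * Q x" if "x \<ge> 0"
        using Q_nonneg[OF that] mult_left_mono[of T "max 0 (T - x)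
            + x" "Q x"] by (simp add: algebra_simps)
      hence "ennreal (Q x) * ennreal T \<le> ennreal (Q x) * ennreal (max 0 (T - x))
          + ennreal (x * Q x)" if "x \<ge> 0"
        using Q_nonneg[OF that] that \<open>T \<ge> 0\<close>
        by (simp flip: ennreal_mult ennreal_plus del: ennreal_max_0)
      thus "ennreal (Q x) * indicator {0..} x * ennreal T
         \<le> ennreal (Q x) * ennreal (T - x) * indicator {0..} x
             + ennreal (x * Q x) * indicator {0..} x"
        by (auto split: split_indicator)
    qed
    also have "\<dots> = (\<integral>\<^sup>+\<omega>. vol T \<omega> \<partial>M) + ennreal (enn2real ?c)"
      using that fin by (subst nn_integral_add) (auto simp: nn_integral_vol)
    finally show ?thesis .
  qed
  thus ?thesis using that[of "enn2real ?c"] by auto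
qed

text \<open>The events factorise unless the windows overlap, in which case the probability is at most
  the geometric mean of the two marginals; this decays in \<open>x\<close> and \<open>y\<close>, and for given \<open>x\<close> and
  \<open>y\<close> the overlap has length \<open>x + y\<close> only. So the variance grows linearly.\<close>

lemma prob_pair_le:
  assumes "0 \<le> x" "x \<le> t" "0 \<le> y" "y \<le> s"
  shows "emeasure M {\<omega>\<in>space M. B x t \<omega> \<and> B y s \<omega>} \<le>
     ennreal (Q x) * ennreal (Q y) + ennreal (sqrt (Q x)) * ennreal (sqrt (Q y))
         * indicator {t - x<..<t + y} s"
proof -
  let ?P = "prob {\<omega>\<in>space M. B x t \<omega> \<and> B y s \<omega>}"
  have sep: "?P \<le> Q x * Q y" if notin: "s \<notin> {t - x<..<t + y}"
  proof -
    consider "s \<le> t - x" | "t \<le> s - y" using notin by fastforce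
    thus ?thesis
    proof cases
      case 1 thus ?thesis using prob2[of x y s t] assms by simp
    next
      case 2
      have "{\<omega>\<in>space M. B x t \<omega> \<and> B y s \<omega>} = {\<omega>\<in>space M. B y s \<omega> \<and> B x t \<omega>}" by auto
      thus ?thesis using prob2[of y x t s] assms 2 by (simp add: mult.commute)
    qed
  qed
  have "?P \<le> Q x" "?P \<le> Q y"
    using prob1[of x t] prob1[of y s] assms by (auto intro!: finite_measure_mono simp flip: prob1)
  hence "?P * ?P \<le> Q x * Q y" by (intro mult_mono) (use assms Q_nonneg in auto)
  hence "?P \<le> sqrt (Q x) * sqrt (Q y)"
    using real_le_rsqrt[of ?P "Q x * Q y"] by (simp add: power2_eq_square real_sqrt_mult)
  moreover have "0 \<le> Q x * Q y" using assms Q_nonneg by simp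
  ultimately have "?P \<le> Q x * Q y + sqrt (Q x) * sqrt (Q y) * indicator {t - x<..<t + y} s"
    using sep by (auto split: split_indicator)
  hence "ennreal ?P \<le> ennreal (Q x * Q y + sqrt (Q x) * sqrt (Q y) * indicator {t - x<..<t + y} s)"
    by (rule ennreal_leI)
  also have "\<dots> = ennreal (Q x) * ennreal (Q y) + ennreal (sqrt (Q x)) * ennreal (sqrt (Q y))
      * indicator {t - x<..<t + y} s"
    using assms Q_nonneg by (auto simp: ennreal_mult split: split_indicator)
  finally show ?thesis by (simp add: emeasure_eq_measure)
qed

lemma second_moment:
  obtains K where "K \<ge> 0" "\<And>T. T \<ge> 0 \<Longrightarrow> (\<integral>\<^sup>+\<omega>. (vol T \<omega>)\<^sup>2 \<partial>M) \<le> ennreal ((c * T)\<^sup>2 + K * T)"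
proof -
  \<comment> \<open>The geometric mean is a product in \<open>x\<close> and \<open>y\<close>, so the
    fourfold integral below separates; the square root merely halves the decay rate.\<close>
  define R where "R x = sqrt (Q x)" for x
  have [measurable]: "R \<in> borel_measurable borel" unfolding R_def by measurable
  have R_le: "R x \<le> sqrt C * exp (- (g / 2) * x)" if "x \<ge> 0" for x
  proof -
    have "R x \<le> sqrt (C * exp (- g * x))" unfolding R_def using Q_le[OF that] by simp
    also have "exp (- g * x) = (exp (- (g / 2) * x))\<^sup>2"
      by (simp flip: exp_of_nat_mult)
    finally show ?thesis by (simp add: real_sqrt_mult)
  qed
  define r0 where "r0 = (\<integral>\<^sup>+x. ennreal (R x) * indicator {0..} x \<partial>lborel)"
  define r1 where "r1 = (\<integral>\<^sup>+x. ennreal (x * R x) * indicator {0..} x \<partial>lborel)"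
  have r: "r0 < \<infinity>" "r1 < \<infinity>"
    unfolding r0_def r1_def using g C
    by (intro nn_integral_exp_bound_finite[OF _ R_le] nn_integral_mult_exp_bound_finite[OF _ R_le];
        simp)+
  have R0: "R x \<ge> 0" if "x \<ge> 0" for x unfolding R_def using Q_nonneg[OF that] by simp
  have bound: "(\<integral>\<^sup>+\<omega>. (vol T \<omega>)\<^sup>2 \<partial>M) \<le> ennreal ((c * T)\<^sup>2) + (r0 * r1
      + r0 * r1) * ennreal T" if T: "T \<ge> 0" for T
  proof -
    \<comment> \<open>\<open>G\<close> drops the constraints \<open>x \<le> t\<close> and
      \<open>y \<le> s\<close>, so that \<open>x\<close> and \<open>y\<close> range over half-lines
      independently of the times.\<close>
    define G where "G p p' = (ennreal (Q (fst p)) * ennreal (Q (fst p')) +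
        ennreal (R (fst p)) * ennreal (R (fst p')) * indicator {snd p - fst p<..<snd p
            + fst p'} (snd p'))
        * indicator {0..} (fst p) * indicator {0..} (fst p') * indicator {0..T} (snd p)
            * indicator {0..T} (snd p')"
      for p p' :: "real \<times> real"
    have [measurable]: "case_prod G \<in> borel_measurable (W \<Otimes>\<^sub>M W)"
    proof -
      have "indicator {snd p - fst p<..<snd p + fst p'} (snd p') =
         (if snd p - fst p < snd p' \<and> snd p' < snd p + fst p' then 1 else
             (0::ennreal))" for p p' :: "real \<times> real"
        by (auto split: split_indicator)
      thus ?thesis unfolding G_def by simp
    qed
    have "(\<integral>\<^sup>+\<omega>. (vol T \<omega>)\<^sup>2 \<partial>M) = (\<integral>\<^sup>+\<omega>. (\<integral>\<^sup>+p. ind T p \<omega> \<partial>W)\<^sup>2 \<partial>M)"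
      by (intro nn_integral_cong) (simp add: vol_eq)
    also have "\<dots> = (\<integral>\<^sup>+p. \<integral>\<^sup>+p'. \<integral>\<^sup>+\<omega>. ind T p \<omega> * ind T p' \<omega> \<partial>M \<partial>W \<partial>W)"
      by (rule nn_integral_square[OF sigma_finite_W prob_space_axioms]) measurable
    also have "\<dots> \<le> (\<integral>\<^sup>+p. \<integral>\<^sup>+p'. G p p' \<partial>W \<partial>W)"
    proof (intro nn_integral_mono)
      fix p p' :: "real \<times> real"
      obtain x t y s where p: "p = (x, t)" "p' = (y, s)" by (cases p, cases p')
      show "(\<integral>\<^sup>+\<omega>. ind T p \<omega> * ind T p' \<omega> \<partial>M) \<le> G p p'"
      proof (cases "0 \<le> x \<and> x \<le> t \<and> t \<le> T \<and> 0 \<le> y \<and> y \<le> s \<and> s \<le> T")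
        case True
        have "(\<integral>\<^sup>+\<omega>. ind T p \<omega> * ind T p' \<omega> \<partial>M) = (\<integral>\<^sup>+\<omega>. indicator {\<omega>\<in>space M. B x t \<omega>
            \<and> B y s \<omega>} \<omega> \<partial>M)"
          using True by (intro nn_integral_cong) (auto simp: ind_def region_def p split:
              split_indicator)
        also have "\<dots> = emeasure M {\<omega>\<in>space M. B x t \<omega> \<and> B y s \<omega>}"
        proof (rule nn_integral_indicator)
          have "{\<omega>\<in>space M. B x t \<omega> \<and> B y s \<omega>} = {\<omega>\<in>space M. B x t \<omega>} \<inter> {\<omega>\<in>space M. B y s \<omega>}"
              by auto
          thus "{\<omega>\<in>space M. B x t \<omega> \<and> B y s \<omega>} \<in> events" using events_B by auto
        qed
        also have "\<dots> \<le> G p p'"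
          using True prob_pair_le[of x t y s] by (simp add: G_def p R_def)
        finally show ?thesis .
      next
        case False
        hence zero: "(\<lambda>\<omega>. ind T p \<omega> * ind T p' \<omega>) = (\<lambda>_. 0)"
            by (auto simp: ind_def region_def p fun_eq_iff split: split_indicator)
        show ?thesis unfolding zero by simp
      qed
    qed
    also have "\<dots> = (\<integral>\<^sup>+x. \<integral>\<^sup>+t. \<integral>\<^sup>+y. \<integral>\<^sup>+s. G (x, t) (y, s) \<partial>lborel \<partial>lborel \<partial>lborel \<partial>lborel)"
    proof -
      interpret W: sigma_finite_measure W by (rule sigma_finite_W)
      have "G p \<in> borel_measurable W" for p
        using measurable_Pair2[of "case_prod G" W W borel p] by (simp add: space_pair_measure)
      hence 1: "(\<integral>\<^sup>+p'. G p p' \<partial>W) = (\<integral>\<^sup>+y. \<integral>\<^sup>+s. G p (y, s) \<partial>lborel \<partial>lborel)" for p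
        by (subst lborel.nn_integral_fst[symmetric]) simp_all
      show ?thesis unfolding 1[symmetric]
        by (subst lborel.nn_integral_fst[symmetric]) simp_all
    qed
    also have "\<dots> \<le> (\<integral>\<^sup>+x. \<integral>\<^sup>+t. \<integral>\<^sup>+y.
        ((ennreal (Q x) * indicator {0..} x * ennreal T) * (ennreal (Q y) * indicator {0..} y)
         + ((ennreal (x * R x) * indicator {0..} x) * (ennreal (R y) * indicator {0..} y)
         + (ennreal (R x) * indicator {0..} x) * (ennreal (y * R y) * indicator {0..} y)))
             * indicator {0..T} t \<partial>lborel \<partial>lborel \<partial>lborel)"
    proof (intro nn_integral_mono)
      fix x t y :: real
      show "(\<integral>\<^sup>+s. G (x, t) (y, s) \<partial>lborel) \<le> 
        ((ennreal (Q x) * indicator {0..} x * ennreal T) * (ennreal (Q y) * indicator {0..} y)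
         + ((ennreal (x * R x) * indicator {0..} x) * (ennreal (R y) * indicator {0..} y)
         + (ennreal (R x) * indicator {0..} x) * (ennreal (y * R y) * indicator {0..} y)))
             * indicator {0..T} t"
      proof (cases "x \<ge> 0 \<and> y \<ge> 0 \<and> t \<in> {0..T}")
        case True
        have "(\<integral>\<^sup>+s. G (x, t) (y, s) \<partial>lborel) \<le> (\<integral>\<^sup>+s. ennreal (Q x) * ennreal (Q y)
            * indicator {0..T} s +
            ennreal (R x) * ennreal (R y) * indicator {t - x<..<t + y} s \<partial>lborel)"
          using True by (intro nn_integral_mono) (auto simp: G_def split: split_indicator)
        also have "\<dots> = ennreal (Q x) * ennreal (Q y) * ennreal T
            + ennreal (R x) * ennreal (R y) * ennreal (x + y)"
          using True T by (subst nn_integral_add) (auto simp: nn_integral_cmult add.commute[of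
              "ennreal y"])
        \<comment> \<open>The times \<open>s\<close> of overlapping windows form an interval of
          length \<open>x + y\<close>; its two summands lead to \<open>r1 * r0\<close> and
          \<open>r0 * r1\<close>.\<close>
        also have "ennreal (R x) * ennreal (R y) * ennreal (x + y) =
            ennreal (x * R x) * ennreal (R y) + ennreal (R x) * ennreal (y * R y)"
          using True R0 by (simp add: ennreal_mult ennreal_plus algebra_simps)
        finally show ?thesis using True by (simp add: mult_ac)
      next
        case False
        hence "G (x, t) (y, s) = 0" for s by (auto simp: G_def split: split_indicator)
        thus ?thesis by simp
      qed
    qed
    also have "\<dots> = (\<integral>\<^sup>+x. \<integral>\<^sup>+t. 
        ((ennreal (Q x) * indicator {0..} x) * (ennreal T * ennreal c)
         + ((ennreal (x * R x) * indicator {0..} x) * r0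
         + (ennreal (R x) * indicator {0..} x) * r1)) * indicator {0..T} t \<partial>lborel \<partial>lborel)"
      by (intro nn_integral_cong)
         (simp add: nn_integral_multc nn_integral_add nn_integral_cmult nn_integral_Q
             r0_def[symmetric] r1_def[symmetric] mult.assoc)
    also have "\<dots> = (\<integral>\<^sup>+x. 
        ((ennreal (Q x) * indicator {0..} x) * (ennreal T * ennreal c)
         + ((ennreal (x * R x) * indicator {0..} x) * r0
         + (ennreal (R x) * indicator {0..} x) * r1)) * ennreal T \<partial>lborel)"
      using T by (intro nn_integral_cong) (simp add: nn_integral_cmult)
    also have "\<dots> = (ennreal c * (ennreal T * ennreal c) + (r1 * r0 + r0 * r1)) * ennreal T"
      by (simp add: nn_integral_multc nn_integral_add nn_integral_Q r0_def[symmetric]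
          r1_def[symmetric])
    also have "\<dots> = ennreal ((c * T)\<^sup>2) + (r0 * r1 + r0 * r1) * ennreal T"
      using c T by (simp add: algebra_simps ennreal_mult power2_eq_square)
    finally show ?thesis .
  qed
  define K where "K = enn2real (r0 * r1 + r0 * r1)"
  have K: "ennreal K = r0 * r1 + r0 * r1"
    unfolding K_def using r by (intro ennreal_enn2real) (auto simp: ennreal_mult_less_top)
  have "(\<integral>\<^sup>+\<omega>. (vol T \<omega>)\<^sup>2 \<partial>M) \<le> ennreal ((c * T)\<^sup>2 + K * T)" if "T \<ge> 0" for T
    using bound[OF that] that unfolding K[symmetric] by (simp add: ennreal_mult ennreal_plus K_def)
  thus ?thesis using that[of K] by (auto simp: K_def)
qed

section \<open>Almost sure convergence of the time average\<close>

definition rvol :: "real \<Rightarrow> 'w \<Rightarrow> real" where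
  "rvol T \<omega> = enn2real (vol T \<omega>)"

lemma ennreal_rvol: "T \<ge> 0 \<Longrightarrow> ennreal (rvol T \<omega>) = vol T \<omega>"
  unfolding rvol_def using vol_le[of T \<omega>] by (intro ennreal_enn2real) (auto intro: le_less_trans)

lemma rvol_nonneg: "rvol T \<omega> \<ge> 0"
  by (simp add: rvol_def)

lemma rvol_le: "T \<ge> 0 \<Longrightarrow> rvol T \<omega> \<le> T * T"
  using vol_le[of T \<omega>] by (simp flip: ennreal_rvol)

lemma rvol_mono:
  assumes "\<omega> \<in> space M" "0 \<le> s" "s \<le> t"
  shows "rvol s \<omega> \<le> rvol t \<omega>"
proof -
  have "vol s \<omega> \<le> vol t \<omega>"
    unfolding vol_def using assms by (intro emeasure_mono sets_region) (auto simp: region_def)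
  thus ?thesis using assms by (simp flip: ennreal_rvol add: rvol_nonneg)
qed

lemma measurable_rvol [measurable]: "rvol T \<in> borel_measurable M"
  unfolding rvol_def by measurable

text \<open>The deviation is taken from \<open>c * T\<close> instead of the mean. The bias
  \<open>c1\<close> then appears multiplied by \<open>2 * c * T\<close>, so the bound stays
  linear.\<close>

lemma variance_bound:
  obtains K where "K \<ge> 0" "\<And>T. T \<ge> 0 \<Longrightarrow> (\<integral>\<^sup>+\<omega>. ennreal ((rvol T \<omega> - c * T)\<^sup>2) \<partial>M) \<le> ennreal (K * T)"
proof -
  obtain c1 where c1: "c1 \<ge> 0" "\<And>T. T \<ge> 0 \<Longrightarrow> ennreal (c * T) \<le> (\<integral>\<^sup>+\<omega>. vol T \<omega> \<partial>M) + ennreal c1"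
    using first_moment by blast
  obtain K where K: "K \<ge> 0" "\<And>T. T \<ge> 0 \<Longrightarrow> (\<integral>\<^sup>+\<omega>. (vol T \<omega>)\<^sup>2 \<partial>M) \<le> ennreal ((c * T)\<^sup>2 + K * T)"
    using second_moment by blast
  have "(\<integral>\<^sup>+\<omega>. ennreal ((rvol T \<omega> - c * T)\<^sup>2) \<partial>M) \<le>
      ennreal ((K + 2 * c * c1) * T)" if T: "T \<ge> 0" for T
  proof -
    have i1: "integrable M (rvol T)"
      using rvol_le[OF T] rvol_nonneg by (intro integrable_const_bound[of _ "T * T"]) auto
    have i2: "integrable M (\<lambda>\<omega>. (rvol T \<omega>)\<^sup>2)"
      using power_mono[OF rvol_le[OF T] rvol_nonneg, of _ 2]
          by (intro integrable_const_bound[of _ "(T * T)\<^sup>2"]) auto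
    have "c * T \<le> expectation (rvol T) + c1"
    proof -
      have "(\<integral>\<^sup>+\<omega>. vol T \<omega> \<partial>M) = ennreal (expectation (rvol T))"
        using T i1 by (subst nn_integral_eq_integral[symmetric])
            (auto simp: ennreal_rvol rvol_nonneg)
      thus ?thesis using c1(1) c1(2)[OF T] i1
        by (simp flip: ennreal_plus add: rvol_nonneg)
    qed
    moreover have "expectation (\<lambda>\<omega>. (rvol T \<omega>)\<^sup>2) \<le> (c * T)\<^sup>2 + K * T"
    proof -
      have "(\<integral>\<^sup>+\<omega>. (vol T \<omega>)\<^sup>2 \<partial>M) = ennreal (expectation (\<lambda>\<omega>. (rvol T \<omega>)\<^sup>2))"
        using T i2 by (subst nn_integral_eq_integral[symmetric])
            (auto simp: ennreal_rvol[symmetric] rvol_nonneg ennreal_power)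
      thus ?thesis using K(1) K(2)[OF T] T by (simp add: ennreal_le_iff del: ennreal_plus)
    qed
    moreover have "expectation (\<lambda>\<omega>. (rvol T \<omega> - c * T)\<^sup>2) =
       expectation (\<lambda>\<omega>. (rvol T \<omega>)\<^sup>2) - 2 * (c * T) * expectation (rvol T) + (c * T)\<^sup>2"
    proof -
      have "expectation (\<lambda>\<omega>. (rvol T \<omega> - c * T)\<^sup>2) = expectation (\<lambda>\<omega>. (rvol T \<omega>)\<^sup>2 - 2 * (c
          * T) * rvol T \<omega> + (c * T)\<^sup>2)"
        by (simp add: power2_diff algebra_simps)
      also have "\<dots> = expectation (\<lambda>\<omega>. (rvol T \<omega>)\<^sup>2) - 2 * (c * T) * expectation (rvol T)
          + (c * T)\<^sup>2"
        using i1 i2 by (subst Bochner_Integration.integral_add) (auto simp: prob_space)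
      finally show ?thesis .
    qed
    ultimately have "expectation (\<lambda>\<omega>. (rvol T \<omega> - c * T)\<^sup>2) \<le> (K + 2 * c * c1) * T"
      using c T mult_left_mono[of "c * T" "expectation (rvol T) + c1" "2 * (c * T)"]
      by (simp add: power2_eq_square algebra_simps)
    moreover have "integrable M (\<lambda>\<omega>. (rvol T \<omega> - c * T)\<^sup>2)"
      using i1 i2 by (simp add: power2_diff)
    ultimately show ?thesis
      by (subst nn_integral_eq_integral) (auto intro!: ennreal_leI)
  qed
  thus ?thesis using K c1 c by (intro that[of "K + 2 * c * c1"]) auto
qed

text \<open>The squared deviations of the time average at \<open>T = (k + 1)^2\<close> have means at
  most \<open>K / (k + 1)^2\<close>. Their series therefore has a finite mean, is almost surely
  finite, and its terms tend to 0.\<close>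

lemma AE_rvol_squares: "AE \<omega> in M. (\<lambda>k. rvol ((real k)\<^sup>2) \<omega> / (real k)\<^sup>2) \<longlonglongrightarrow> c"
proof -
  obtain K where K: "K \<ge> 0" "\<And>T. T \<ge> 0 \<Longrightarrow> (\<integral>\<^sup>+\<omega>. ennreal ((rvol T \<omega> - c * T)\<^sup>2) \<partial>M) \<le>
      ennreal (K * T)"
    using variance_bound by blast
  define T where "T k = (real (Suc k))\<^sup>2" for k
  define Y where "Y k \<omega> = (rvol (T k) \<omega> / T k - c)\<^sup>2" for k \<omega>
  have T0: "T k > 0" for k by (simp add: T_def)
  have [measurable]: "Y k \<in> borel_measurable M" for k unfolding Y_def by measurable
  have Y_le: "(\<integral>\<^sup>+\<omega>. ennreal (Y k \<omega>) \<partial>M) \<le> ennreal (K / T k)" for k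
  proof -
    have "(\<integral>\<^sup>+\<omega>. ennreal (Y k \<omega>) \<partial>M) = (\<integral>\<^sup>+\<omega>. ennreal (1 / (T k)\<^sup>2)
        * ennreal ((rvol (T k) \<omega> - c * T k)\<^sup>2) \<partial>M)"
    proof (intro nn_integral_cong)
      fix \<omega>
      have "rvol (T k) \<omega> / T k - c = (rvol (T k) \<omega> - c * T k) / T k"
        using T0[of k] by (simp add: field_simps)
      hence "Y k \<omega> = 1 / (T k)\<^sup>2 * (rvol (T k) \<omega> - c * T k)\<^sup>2"
        unfolding Y_def by (simp add: power_divide)
      thus "ennreal (Y k \<omega>) = ennreal (1 / (T k)\<^sup>2) * ennreal ((rvol (T k) \<omega> - c * T k)\<^sup>2)"
        by (simp only:) (rule ennreal_mult, auto)
    qed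
    also have "\<dots> = ennreal (1 / (T k)\<^sup>2) * (\<integral>\<^sup>+\<omega>. ennreal ((rvol (T k) \<omega> - c * T k)\<^sup>2) \<partial>M)"
      by (rule nn_integral_cmult) measurable
    also have "\<dots> \<le> ennreal (1 / (T k)\<^sup>2) * ennreal (K * T k)"
      using T0[of k] by (intro mult_left_mono K(2)) auto
    also have "\<dots> = ennreal (K / T k)"
      using T0[of k] K(1) by (simp flip: ennreal_mult add: power2_eq_square)
    finally show ?thesis .
  qed
  have "(\<integral>\<^sup>+\<omega>. (\<Sum>k. ennreal (Y k \<omega>)) \<partial>M) = (\<Sum>k. \<integral>\<^sup>+\<omega>. ennreal (Y k \<omega>) \<partial>M)"
    by (rule nn_integral_suminf) measurable
  also have "\<dots> \<le> (\<Sum>k. ennreal (K / T k))"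
    by (intro suminf_le Y_le) auto
  also have "\<dots> < \<infinity>"
  proof -
    have "summable (\<lambda>k. inverse (real (Suc k) ^ 2))"
      by (subst summable_Suc_iff) (rule inverse_power_summable, simp)
    hence "summable (\<lambda>k. K * inverse (real (Suc k) ^ 2))" by (rule summable_mult)
    hence "summable (\<lambda>k. K / T k)" by (simp add: T_def divide_inverse)
    thus ?thesis using K(1) T0 by (subst suminf_ennreal2) (auto intro!: divide_nonneg_pos)
  qed
  finally have "AE \<omega> in M. (\<Sum>k. ennreal (Y k \<omega>)) \<noteq> \<infinity>"
    by (intro nn_integral_PInf_AE) auto
  thus ?thesis
  proof eventually_elim
    case (elim \<omega>)
    have "summable (\<lambda>k. Y k \<omega>)"
      using elim by (intro summable_suminf_not_top) (auto simp: Y_def)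
    hence "(\<lambda>k. Y k \<omega>) \<longlonglongrightarrow> 0" by (rule summable_LIMSEQ_zero)
    hence "(\<lambda>k. sqrt (Y k \<omega>)) \<longlonglongrightarrow> sqrt 0" by (intro tendsto_intros)
    hence "(\<lambda>k. \<bar>rvol (T k) \<omega> / T k - c\<bar>) \<longlonglongrightarrow> 0" by (simp add: Y_def)
    hence "(\<lambda>k. rvol (T k) \<omega> / T k - c) \<longlonglongrightarrow> 0" by (simp add: tendsto_rabs_zero_iff)
    hence "(\<lambda>k. rvol (T k) \<omega> / T k) \<longlonglongrightarrow> c" by (simp add: LIM_zero_iff)
    thus ?case unfolding T_def by (rule LIMSEQ_imp_Suc)
  qed
qed

theorem AE_rvol_tendsto: "AE \<omega> in M. ((\<lambda>T. rvol T \<omega> / T) \<longlongrightarrow> c) at_top"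
  using AE_rvol_squares AE_space
proof eventually_elim
  case (elim \<omega>)
  define k where "k T = nat \<lfloor>sqrt T\<rfloor>" for T
  define v where "v k = rvol ((real k)\<^sup>2) \<omega> / (real k)\<^sup>2" for k
  have v: "v \<longlonglongrightarrow> c" using elim(1) by (simp add: v_def[abs_def])
  have k_top: "filterlim k at_top at_top"
    unfolding k_def
    by (intro filterlim_compose[OF filterlim_nat_sequentially] filterlim_compose[OF
        filterlim_floor_sequentially] sqrt_at_top)
  \<comment> \<open>Between \<open>m^2\<close> and \<open>(m + 1)^2\<close> numerator and
    denominator are each moved to an endpoint; the loss is the factor
    \<open>(m / (m + 1))^2\<close>, which tends to 1.\<close>
  have r: "(\<lambda>k. (real k / real (Suc k))\<^sup>2) \<longlonglongrightarrow> 1\<^sup>2"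
    by (intro tendsto_power LIMSEQ_n_over_Suc_n)
  have lo: "(\<lambda>k. v k * (real k / real (Suc k))\<^sup>2) \<longlonglongrightarrow> c"
    using tendsto_mult[OF v r] by simp
  have hi: "(\<lambda>k. v (Suc k) / (real k / real (Suc k))\<^sup>2) \<longlonglongrightarrow> c"
    using tendsto_divide[OF LIMSEQ_Suc[OF v] r] by simp
  show ?case
  proof (rule tendsto_sandwich)
    show "((\<lambda>T. v (k T) * (real (k T) / real (Suc (k T)))\<^sup>2) \<longlongrightarrow> c) at_top"
      by (rule filterlim_compose[OF lo k_top])
    show "((\<lambda>T. v (Suc (k T)) / (real (k T) / real (Suc (k T)))\<^sup>2) \<longlongrightarrow> c) at_top"
      by (rule filterlim_compose[OF hi k_top])
    have ev: "eventually (\<lambda>T. v (k T) * (real (k T) / real (Suc (k T)))\<^sup>2 \<le> rvol T \<omega> / T \<and>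
       rvol T \<omega> / T \<le> v (Suc (k T)) / (real (k T) / real (Suc (k T)))\<^sup>2) at_top"
      using eventually_ge_at_top[of 1]
    proof eventually_elim
      case T: (elim T)
      define m where "m = k T"
      have m1: "real m \<le> sqrt T" "sqrt T < real (Suc m)" "m \<ge> 1"
        using T unfolding m_def k_def by (auto simp: le_nat_iff le_floor_iff) linarith+
      have m2: "(real m)\<^sup>2 \<le> T" "T \<le> (real (Suc m))\<^sup>2"
        using T power_mono[OF m1(1), of 2] power_mono[OF less_imp_le[OF m1(2)], of 2] by auto
      have m0: "real m > 0" using m1 by simp
      have "v m * (real m / real (Suc m))\<^sup>2 = rvol ((real m)\<^sup>2) \<omega> / (real (Suc m))\<^sup>2"
        using m0 by (simp add: v_def power_divide)
      also have "\<dots> \<le> rvol T \<omega> / T"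
        using m2 T elim(2) by (intro frac_le rvol_mono rvol_nonneg) auto
      finally have 1: "v m * (real m / real (Suc m))\<^sup>2 \<le> rvol T \<omega> / T" .
      have "rvol T \<omega> / T \<le> rvol ((real (Suc m))\<^sup>2) \<omega> / (real m)\<^sup>2"
        using m2 T m0 elim(2) by (intro frac_le rvol_mono rvol_nonneg) auto
      also have "\<dots> = v (Suc m) / (real m / real (Suc m))\<^sup>2"
        using m0 by (simp add: v_def power_divide del: of_nat_Suc)
      finally show ?case using 1 by (simp add: m_def)
    qed
    show "eventually (\<lambda>T. v (k T) * (real (k T) / real (Suc (k T)))\<^sup>2 \<le> rvol T \<omega> / T) at_top"
      using ev by eventually_elim simp
    show "eventually (\<lambda>T. rvol T \<omega> / T \<le> v (Suc (k T)) / (real (k T) / real (Suc (k T)))\<^sup>2) at_top"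
      using ev by eventually_elim simp
  qed
qed

end

section \<open>One-step identities for exponential interarrival and service times\<close>

abbreviation expo :: "real \<Rightarrow> real measure" where
  "expo l \<equiv> density lborel (exponential_density l)"

lemma AE_expo_nonneg: "AE x in expo l. x \<ge> 0"
  by (subst AE_density) (auto simp: exponential_density_def)

lemma nn_integral_expo:
  assumes "l > 0" and [measurable]: "f \<in> borel_measurable borel"
  shows "(\<integral>\<^sup>+x. f x \<partial>expo l) = (\<integral>\<^sup>+x. ennreal (l * exp (- l * x)) * f x
      * indicator {0..} x \<partial>lborel)"
  by (subst nn_integral_density)
     (auto simp: exponential_density_def mult_ac intro!: nn_integral_cong split: split_indicator)

text \<open>Memorylessness in integral form: given that \<open>x\<close> exceeds \<open>z\<close>,
  the excess \<open>x - z\<close> again has law \<open>expo l\<close>.\<close>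

lemma nn_integral_expo_memoryless:
  assumes l: "l > 0" and z: "z \<ge> 0" and f [measurable]: "f \<in> borel_measurable borel"
  shows "(\<integral>\<^sup>+x. indicator {z<..} x * f (x - z) \<partial>expo l) =
      ennreal (exp (- l * z)) * (\<integral>\<^sup>+x. f x \<partial>expo l)"
proof -
  have "(\<integral>\<^sup>+x. indicator {z<..} x * f (x - z) \<partial>expo l) =
    (\<integral>\<^sup>+x. ennreal (l * exp (- l * x)) * (indicator {z<..} x * f (x - z))
        * indicator {0..} x \<partial>lborel)"
    by (rule nn_integral_expo[OF l]) measurable
  also have "\<dots> = (\<integral>\<^sup>+x. ennreal (l * exp (- l * (z + x))) * (indicator {z<..} (z
      + x) * f x) * indicator {0..} (z + x) \<partial>lborel)"
    by (subst nn_integral_real_affine[of _ 1 z]) auto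
  also have "\<dots> = (\<integral>\<^sup>+x. ennreal (exp (- l * z)) * (ennreal (l * exp (- l * x)) * f x
      * indicator {0..} x) \<partial>lborel)"
  proof (intro nn_integral_cong_AE)
    have ex: "ennreal (l * exp (- l * (z + x))) = ennreal (exp (- l * z)) * ennreal (l
        * exp (- l * x))" for x
      using l by (simp flip: ennreal_mult exp_add add: algebra_simps)
    \<comment> \<open>For \<open>z = 0\<close> and more generally at the shifted point 0, the
      indicator of \<open>{z<..}\<close> vanishes while that of \<open>{0..}\<close> does not; one
      point has measure 0.\<close>
    have "AE x in lborel. x \<noteq> (0::real)" by (rule AE_lborel_singleton)
    thus "AE x in lborel. ennreal (l * exp (- l * (z + x))) * (indicator {z<..} (z
        + x) * f x) * indicator {0..} (z + x)
       = ennreal (exp (- l * z)) * (ennreal (l * exp (- l * x)) * f x * indicator {0..} x)"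
    proof eventually_elim
      case (elim x)
      thus ?case using z unfolding ex by (cases "x > 0") (auto simp: mult_ac split: split_indicator)
    qed
  qed
  also have "\<dots> = ennreal (exp (- l * z)) * (\<integral>\<^sup>+x. f x \<partial>expo l)"
    by (subst nn_integral_cmult) (auto simp: nn_integral_expo[OF l])
  finally show ?thesis .
qed

lemma emeasure_expo_greaterThan:
  assumes "l > 0" "z \<ge> 0"
  shows "emeasure (expo l) {z<..} = ennreal (exp (- l * z))"
proof -
  interpret prob_space "expo l" by (rule prob_space_exponential_density[OF assms(1)])
  show ?thesis
    using nn_integral_expo_memoryless[OF assms, of "\<lambda>_. 1"] emeasure_space_1 by simp
qed

lemma emeasure_expo_atLeast:
  assumes "l > 0" "z \<ge> 0"
  shows "emeasure (expo l) {z..} = ennreal (exp (- l * z))"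
proof -
  have "AE x in expo l. x \<noteq> z" by (subst AE_density)
      (auto intro: AE_mp[OF AE_lborel_singleton[of z]])
  hence "emeasure (expo l) {z..} = emeasure (expo l) {z<..}"
    by (intro emeasure_eq_AE) (auto elim!: eventually_mono)
  thus ?thesis using emeasure_expo_greaterThan[OF assms] by simp
qed

text \<open>Here \<open>a\<close> is the time to the next arrival and \<open>d\<close> the time left
  in the window: to avoid a delivery, service must outlast the shorter of the two. If the window is
  already closed, \<open>d < 0\<close>, the event is almost sure since service times are
  nonnegative.\<close>

lemma emeasure_expo_service:
  assumes "l > 0" "a \<ge> 0"
  shows "emeasure (expo l) {s. \<not> (s < a \<and> s \<le> d)} = ennreal (exp (- l * max 0 (min a d)))"
proof -
  interpret prob_space "expo l" by (rule prob_space_exponential_density[OF assms(1)])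
  consider "d < 0" | "0 \<le> d" "a \<le> d" | "0 \<le> d" "d < a" by linarith
  thus ?thesis
  proof cases
    case 1
    have "{s. \<not> (s < a \<and> s \<le> d)} = UNIV - {s. s < a \<and> s \<le> d}" by auto
    hence m: "{s. \<not> (s < a \<and> s \<le> d)} \<in> sets borel" by simp
    have "emeasure (expo l) {s. \<not> (s < a \<and> s \<le> d)} = emeasure (expo l) (space (expo l))"
      using AE_expo_nonneg[of l] 1 m by (intro emeasure_eq_AE) (auto elim!: eventually_mono)
    thus ?thesis using 1 emeasure_space_1 by simp
  next
    case 2
    hence "{s. \<not> (s < a \<and> s \<le> d)} = {a..}" by auto
    thus ?thesis using 2 assms by (simp add: emeasure_expo_atLeast max_def min_def)
  next
    case 3
    hence "{s. \<not> (s < a \<and> s \<le> d)} = {d<..}" by auto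
    thus ?thesis using 3 assms by (simp add: emeasure_expo_greaterThan max_def min_def)
  qed
qed

text \<open>Condition on the first arrival \<open>a\<close>: the service then has to last for the
  remaining \<open>x - a\<close>, and for \<open>a > x\<close> nothing is required. So
  \<open>stale\<close> is the tail of the sum of both exponential variables.\<close>

lemma nn_integral_expo_stale:
  assumes lam: "lam > 0" and x: "x \<ge> 0"
  shows "(\<integral>\<^sup>+a. ennreal (exp (- mu * max 0 (x - a))) \<partial>expo lam) = ennreal (stale lam mu x)"
proof -
  have "(\<integral>\<^sup>+a. ennreal (exp (- mu * max 0 (x - a))) \<partial>expo lam) =
    (\<integral>\<^sup>+a. ennreal (lam * exp (- lam * a)) * ennreal (exp (- mu * max 0 (x - a)))
        * indicator {0..} a \<partial>lborel)"
    using lam by (intro nn_integral_expo) auto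
  also have "\<dots> = (\<integral>\<^sup>+a. ennreal (lam * exp (- lam * a) * exp (- mu * (x - a)))
      * indicator {0..x} a +
      ennreal (lam * exp (- lam * a)) * indicator {x..} a \<partial>lborel)"
  proof (intro nn_integral_cong_AE)
    show "AE a in lborel. ennreal (lam * exp (- lam * a)) * ennreal (exp (- mu
        * max 0 (x - a))) * indicator {0..} a
      = ennreal (lam * exp (- lam * a) * exp (- mu * (x - a))) * indicator {0..x} a +
      ennreal (lam * exp (- lam * a)) * indicator {x..} a"
      using AE_lborel_singleton[of x]
    proof eventually_elim
      case (elim a)
      thus ?case using lam x by (auto simp flip: ennreal_mult simp: max_def split: split_indicator)
    qed
  qed
  also have "\<dots> = (\<integral>\<^sup>+a. ennreal (lam * exp (- lam * a) * exp (- mu * (x - a)))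
      * indicator {0..x} a \<partial>lborel) +
      (\<integral>\<^sup>+a. ennreal (lam * exp (- lam * a)) * indicator {x..} a \<partial>lborel)"
    by (rule nn_integral_add) measurable
  \<comment> \<open>By its differential equation, \<open>serving lam mu a\<close> times
    \<open>exp (- mu * (x - a))\<close> is an antiderivative of the integrand, also for equal
    rates.\<close>
  also have "(\<integral>\<^sup>+a. ennreal (lam * exp (- lam * a) * exp (- mu * (x - a)))
      * indicator {0..x} a \<partial>lborel)
      = ennreal (exp (- mu * (x - x)) * serving lam mu x - exp (- mu * (x - 0)) * serving lam mu 0)"
    using lam x by (intro nn_integral_FTC_Icc) (auto intro!: derivative_eq_intros simp:
        algebra_simps)
  also have "(\<integral>\<^sup>+a. ennreal (lam * exp (- lam * a)) * indicator {x..} a \<partial>lborel) =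
      ennreal (exp (- lam * x))"
  proof -
    have lim: "((\<lambda>x. - exp (- lam * x)) \<longlongrightarrow> - 0) at_top"
      using lam by (intro tendsto_minus filterlim_compose[OF exp_at_bot]
        filterlim_tendsto_neg_mult_at_bot[OF tendsto_const]) (auto simp: filterlim_ident)
    have "(\<integral>\<^sup>+a. ennreal (lam * exp (- lam * a)) * indicator {x..} a \<partial>lborel) =
        ennreal (- 0 - (- exp (- lam * x)))"
      using lam lim by (intro nn_integral_FTC_atLeast) (auto intro!: derivative_eq_intros)
    thus ?thesis by simp
  qed
  finally show ?thesis
    using serving_nonneg[OF lam x, of mu] by (simp add: stale_def ennreal_plus[symmetric]
        add.commute del: ennreal_plus)
qed

lemma stale_le_1:
  assumes "lam > 0" "mu \<ge> 0" "x \<ge> 0"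
  shows "stale lam mu x \<le> 1"
proof -
  interpret prob_space "expo lam" by (rule prob_space_exponential_density[OF assms(1)])
  have "ennreal (stale lam mu x) \<le> (\<integral>\<^sup>+a. 1 \<partial>expo lam)"
    unfolding nn_integral_expo_stale[OF assms(1,3), symmetric] using assms
        by (intro nn_integral_mono) auto
  also have "\<dots> = 1" using emeasure_space_1 by simp
  finally show ?thesis by simp
qed

section \<open>Conditional probability of quiet windows at an arrival\<close>

text \<open>The conditional probability that a server completes by time \<open>e\<close> no update generated after
  time \<open>c\<close>, given that an update arrives at time \<open>r\<close> and that no earlier one was such.\<close>

definition cond_quiet :: "real \<Rightarrow> real \<Rightarrow> real \<Rightarrow> real \<Rightarrow> real \<Rightarrow> ennreal" where
  "cond_quiet lam mu c e r = (if r \<le> c then ennreal (stale lam mu (e - c)) else ennreal (exp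
      (- mu * max 0 (e - r))))"

lemma measurable_cond_quiet [measurable]: "cond_quiet lam mu c e \<in> borel_measurable borel"
  unfolding cond_quiet_def by measurable

text \<open>As long as the window has not opened, \<open>cond_quiet\<close> keeps its mean: given
  that the next arrival falls after \<open>c\<close>, its delay beyond \<open>c\<close> is again
  exponential, and averaging gives \<open>stale lam mu (e - c)\<close>, the value for arrivals up to
  \<open>c\<close>. The factor \<open>f\<close> stands for an earlier window, which no longer
  matters for arrivals after \<open>c\<close>.\<close>

lemma nn_integral_cond_quiet:
  assumes lam: "lam > 0" and r: "r \<le> c" "c \<le> e" and [measurable]: "f \<in> borel_measurable borel"
    and f: "\<And>a. c < r + a \<Longrightarrow> f a = 1"
  shows "(\<integral>\<^sup>+a. f a * cond_quiet lam mu c e (r + a) \<partial>expo lam) =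
      ennreal (stale lam mu (e - c)) * (\<integral>\<^sup>+a. f a \<partial>expo lam)"
proof -
  define z where "z = c - r"
  have z: "z \<ge> 0" using r by (simp add: z_def)
  define q where "q = ennreal (stale lam mu (e - c))"
  have "(\<integral>\<^sup>+a. f a * cond_quiet lam mu c e (r + a) \<partial>expo lam) =
     (\<integral>\<^sup>+a. q * (f a * indicator {..z} a) + indicator {z<..} a * ennreal (exp (- mu
         * max 0 ((e - c) - (a - z)))) \<partial>expo lam)"
    by (intro nn_integral_cong)
       (auto simp: cond_quiet_def z_def q_def f mult_ac algebra_simps split: split_indicator)
  also have "\<dots> = (\<integral>\<^sup>+a. q * (f a * indicator {..z} a) \<partial>expo lam) +
     (\<integral>\<^sup>+a. indicator {z<..} a * ennreal (exp (- mu * max 0 ((e - c) - (a - z)))) \<partial>expo lam)"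
    by (rule nn_integral_add) measurable
  also have "(\<integral>\<^sup>+a. indicator {z<..} a * ennreal (exp (- mu * max 0 ((e - c) - (a - z)))) \<partial>expo lam)
     = ennreal (exp (- lam * z)) * q"
    unfolding q_def using lam z r nn_integral_expo_stale[of lam "e - c" mu]
    by (subst nn_integral_expo_memoryless[where f="\<lambda>a. ennreal (exp (- mu
        * max 0 ((e - c) - a)))"]) auto
  also have "\<dots> = (\<integral>\<^sup>+a. q * (f a * indicator {z<..} a) \<partial>expo lam)"
  proof -
    have "(\<integral>\<^sup>+a. q * (f a * indicator {z<..} a) \<partial>expo lam) =
        (\<integral>\<^sup>+a. q * indicator {z<..} a \<partial>expo lam)"
      by (intro nn_integral_cong) (auto simp: f z_def split: split_indicator)
    also have "\<dots> = q * ennreal (exp (- lam * z))"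
      by (subst nn_integral_cmult_indicator) (auto simp: emeasure_expo_greaterThan lam z)
    finally show ?thesis by (simp add: mult.commute)
  qed
  also have "(\<integral>\<^sup>+a. q * (f a * indicator {..z} a) \<partial>expo lam) + \<dots> =
     (\<integral>\<^sup>+a. q * (f a * indicator {..z} a) + q * (f a * indicator {z<..} a) \<partial>expo lam)"
    by (rule nn_integral_add[symmetric]) measurable
  also have "\<dots> = (\<integral>\<^sup>+a. q * f a \<partial>expo lam)"
    by (intro nn_integral_cong) (auto split: split_indicator)
  also have "\<dots> = q * (\<integral>\<^sup>+a. f a \<partial>expo lam)" by (rule nn_integral_cmult) measurable
  finally show ?thesis by (simp add: q_def)
qed

text \<open>Probability, over the service time, that the update arriving at \<open>r\<close> is not
  delivered inside the window when the next arrival follows after \<open>a\<close>.\<close>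

definition stay :: "real \<Rightarrow> real \<Rightarrow> real \<Rightarrow> real \<Rightarrow> real \<Rightarrow> ennreal" where
  "stay mu c e r a = (if r \<le> c then 1 else ennreal (exp (- mu * max 0 (min a (e - r)))))"

text \<open>Preemption is harmless: the service exposure inside the window before the next arrival
  and that after it add up to the exposure of one uninterrupted service.\<close>

lemma stay_mult_cond_quiet:
  assumes "c < r" "a \<ge> 0"
  shows "stay mu c e r a * cond_quiet lam mu c e (r + a) = cond_quiet lam mu c e r"
proof -
  have "max 0 (min a (e - r)) + max 0 (e - (r + a)) = max 0 (e - r)" using assms by auto
  hence "- mu * max 0 (min a (e - r)) + - mu * max 0 (e - (r + a)) = - mu * max 0 (e - r)"
    by (simp only: distrib_left[symmetric])
  thus ?thesis
    using assms by (simp add: stay_def cond_quiet_def exp_add[symmetric] ennreal_mult[symmetric])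
qed

definition undelivered_ind :: "real \<Rightarrow> real \<Rightarrow> real \<Rightarrow> real \<Rightarrow> real \<Rightarrow> real \<Rightarrow> real \<Rightarrow> ennreal" where
  "undelivered_ind c1 e1 c2 e2 r a s =
     of_bool (\<not> (s < a \<and> (c1 < r \<and> r + s \<le> e1 \<or> c2 < r \<and> r + s \<le> e2)))"

text \<open>Both windows share one service time, but for each position of \<open>r\<close> at least
  one of the factors is 1: the second as long as \<open>r \<le> c2\<close>, the first afterwards,
  because \<open>e1 \<le> c2\<close>.\<close>

lemma nn_integral_undelivered:
  assumes "mu > 0" "c1 \<le> e1" "e1 \<le> c2" "c2 \<le> e2" "a \<ge> 0"
  shows "(\<integral>\<^sup>+s. undelivered_ind c1 e1 c2 e2 r a s \<partial>expo mu) = stay mu c1 e1 r a * stay mu c2 e2 r a"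
proof -
  interpret prob_space "expo mu" by (rule prob_space_exponential_density[OF assms(1)])
  have key: "(\<integral>\<^sup>+s. undelivered_ind c1 e1 c2 e2 r a s \<partial>expo mu) =
      ennreal (exp (- mu * max 0 (min a (e - r))))"
    if "\<And>s. undelivered_ind c1 e1 c2 e2 r a s = indicator {s. \<not> (s < a \<and> s \<le> e - r)} s" for e
  proof -
    have "{s. \<not> (s < a \<and> s \<le> e - r)} = UNIV - {s. s < a \<and> s \<le> e - r}" by auto
    hence "{s. \<not> (s < a \<and> s \<le> e - r)} \<in> sets borel" by simp
    thus ?thesis
      unfolding that emeasure_expo_service[OF assms(1,5), of "e - r", symmetric] by simp
  qed
  consider "r \<le> c1" | "c1 < r" "r \<le> c2" | "c2 < r" by linarith
  thus ?thesis
  proof cases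
    case 1
    hence "undelivered_ind c1 e1 c2 e2 r a s = 1" for s using assms
        by (auto simp: undelivered_ind_def)
    thus ?thesis using 1 assms emeasure_space_1 by (simp add: stay_def)
  next
    case 2
    thus ?thesis using assms
      by (subst key[of e1]) (auto simp: undelivered_ind_def stay_def algebra_simps split:
          split_indicator)
  next
    case 3
    thus ?thesis using assms
      by (subst key[of e2]) (auto simp: undelivered_ind_def stay_def algebra_simps split:
          split_indicator)
  qed
qed

text \<open>Once \<open>c < r\<close> the product of \<open>stay\<close> and
  \<open>cond_quiet\<close> does not depend on \<open>a \<ge> 0\<close>; for
  \<open>r \<le> c\<close> only the mean over \<open>a\<close> is preserved. If neither window has
  opened, the first factor is 1 whenever the next arrival falls after \<open>c2\<close>, and this
  lets the two means be taken one after the other.\<close>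

lemma cond_quiet_step:
  assumes "lam > 0" "mu > 0" "c1 \<le> e1" "e1 \<le> c2" "c2 \<le> e2"
  shows "(\<integral>\<^sup>+a. (\<integral>\<^sup>+s. undelivered_ind c1 e1 c2 e2 r a s \<partial>expo mu) *
       (cond_quiet lam mu c1 e1 (r + a) * cond_quiet lam mu c2 e2 (r + a)) \<partial>expo lam)
     = cond_quiet lam mu c1 e1 r * cond_quiet lam mu c2 e2 r" (is "?L = _")
proof -
  interpret prob_space "expo lam" by (rule prob_space_exponential_density[OF assms(1)])
  let ?h1 = "cond_quiet lam mu c1 e1" and ?h2 = "cond_quiet lam mu c2 e2"
  have L: "?L = (\<integral>\<^sup>+a. (stay mu c1 e1 r a * ?h1 (r + a)) * (stay mu c2 e2 r a * ?h2 (r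
      + a)) \<partial>expo lam)"
    using AE_expo_nonneg[of lam]
    by (intro nn_integral_cong_AE) (auto elim!: eventually_mono simp: nn_integral_undelivered assms
        mult_ac)
  have one: "emeasure (expo lam) UNIV = 1" using emeasure_space_1 by simp
  have h2: "(\<integral>\<^sup>+a. ?h2 (r + a) \<partial>expo lam) = ?h2 r" if "r \<le> c2"
    using nn_integral_cond_quiet[OF assms(1) that assms(5), of "\<lambda>_. 1" mu] that one
    by (simp add: cond_quiet_def)
  have h1: "(\<integral>\<^sup>+a. ?h1 (r + a) \<partial>expo lam) = ?h1 r" if "r \<le> c1"
    using nn_integral_cond_quiet[OF assms(1) that assms(3), of "\<lambda>_. 1" mu] that one
    by (simp add: cond_quiet_def)
  consider "r \<le> c1" | "c1 < r" "r \<le> c2" | "c2 < r" by linarith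
  thus ?thesis
  proof cases
    case 1
    have "?L = (\<integral>\<^sup>+a. ?h1 (r + a) * ?h2 (r + a) \<partial>expo lam)"
      unfolding L using 1 assms by (simp add: stay_def)
    also have "\<dots> = ennreal (stale lam mu (e2 - c2)) * (\<integral>\<^sup>+a. ?h1 (r + a) \<partial>expo lam)"
      using 1 assms by (intro nn_integral_cond_quiet) (auto simp: cond_quiet_def)
    finally show ?thesis using h1 1 assms by (simp add: cond_quiet_def mult_ac)
  next
    case 2
    have "?L = (\<integral>\<^sup>+a. ?h1 r * ?h2 (r + a) \<partial>expo lam)"
      unfolding L using AE_expo_nonneg[of lam] 2
      by (intro nn_integral_cong_AE) (auto elim!: eventually_mono simp: stay_mult_cond_quiet, simp
          add: stay_def)
    also have "\<dots> = ?h1 r * ?h2 r" using h2 2 by (simp add: nn_integral_cmult)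
    finally show ?thesis .
  next
    case 3
    have "?L = (\<integral>\<^sup>+a. ?h1 r * ?h2 r \<partial>expo lam)"
      unfolding L using AE_expo_nonneg[of lam] 3 assms
      by (intro nn_integral_cong_AE) (auto elim!: eventually_mono simp: stay_mult_cond_quiet)
    thus ?thesis using one by simp
  qed
qed

section \<open>Integrating out one independent variable\<close>

lemma (in prob_space) nn_integral_indep_fresh:
  assumes ind: "indep_vars (\<lambda>_. borel) X I" and P: "P \<subseteq> I" "i \<in> I" "i \<notin> P"
    and f [measurable]: "f \<in> borel_measurable (PiM P (\<lambda>_. borel) \<Otimes>\<^sub>M borel)"
  shows "(\<integral>\<^sup>+\<omega>. f (restrict (\<lambda>k. X k \<omega>) P, X i \<omega>) \<partial>M) =
     (\<integral>\<^sup>+\<omega>. \<integral>\<^sup>+y. f (restrict (\<lambda>k. X k \<omega>) P, y) \<partial>distr M borel (X i) \<partial>M)"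
proof -
  let ?X = "\<lambda>\<omega>. restrict (\<lambda>k. X k \<omega>) P" and ?Y = "\<lambda>\<omega>. restrict (\<lambda>k. X k \<omega>) {i}"
  have "indep_var (PiM P (\<lambda>_. borel)) ?X (PiM {i} (\<lambda>_. borel)) ?Y"
    using P by (intro indep_var_restrict[OF ind]) auto
  hence m [measurable]: "?X \<in> M \<rightarrow>\<^sub>M PiM P (\<lambda>_. borel)" "?Y \<in> M \<rightarrow>\<^sub>M PiM {i} (\<lambda>_. borel)"
    and d: "distr M (PiM P (\<lambda>_. borel)) ?X \<Otimes>\<^sub>M distr M (PiM {i} (\<lambda>_. borel)) ?Y =
        distr M (PiM P (\<lambda>_. borel) \<Otimes>\<^sub>M PiM {i} (\<lambda>_. borel)) (\<lambda>\<omega>. (?X \<omega>, ?Y \<omega>))"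
    unfolding indep_var_distribution_eq by auto
  have i [measurable]: "X i \<in> borel_measurable M" using ind P by (auto simp: indep_vars_def)
  have ev [measurable]: "(\<lambda>y. y i) \<in> borel_measurable (PiM {i} (\<lambda>_. borel))"
    by (rule measurable_component_singleton) simp
  have f' [measurable]: "(\<lambda>z. f (fst z, snd z i))
      \<in> borel_measurable (PiM P (\<lambda>_. borel) \<Otimes>\<^sub>M PiM {i} (\<lambda>_. borel))"
    by measurable
  interpret D: prob_space "distr M (PiM {i} (\<lambda>_. borel)) ?Y" by (rule prob_space_distr) measurable
  have "(\<integral>\<^sup>+\<omega>. f (?X \<omega>, X i \<omega>) \<partial>M) = (\<integral>\<^sup>+z. f (fst z, snd z i) \<partial>(distr M (PiM P
      (\<lambda>_. borel)) ?X \<Otimes>\<^sub>M distr M (PiM {i} (\<lambda>_. borel)) ?Y))"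
    unfolding d by (subst nn_integral_distr) auto
  also have "\<dots> = (\<integral>\<^sup>+x. \<integral>\<^sup>+y. f (x, y i) \<partial>distr M (PiM {i} (\<lambda>_. borel)) ?Y \<partial>distr M (PiM P
      (\<lambda>_. borel)) ?X)"
    by (subst D.nn_integral_fst[symmetric]) auto
  also have "\<dots> = (\<integral>\<^sup>+\<omega>. \<integral>\<^sup>+y. f (?X \<omega>, y i) \<partial>distr M (PiM {i} (\<lambda>_. borel)) ?Y \<partial>M)"
    by (subst nn_integral_distr) auto
  also have "\<dots> = (\<integral>\<^sup>+\<omega>. \<integral>\<^sup>+y. f (?X \<omega>, y) \<partial>distr M borel (X i) \<partial>M)"
  proof (intro nn_integral_cong)
    fix \<omega> assume \<omega>: "\<omega> \<in> space M"
    have x: "?X \<omega> \<in> space (PiM P (\<lambda>_. borel))" using \<omega> m(1) by (rule measurable_space[rotated])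
    have [measurable]: "(\<lambda>y. f (?X \<omega>, y)) \<in> borel_measurable borel"
        by (rule measurable_Pair2[OF f x])
    show "(\<integral>\<^sup>+y. f (?X \<omega>, y i) \<partial>distr M (PiM {i} (\<lambda>_. borel)) ?Y) =
        (\<integral>\<^sup>+y. f (?X \<omega>, y) \<partial>distr M borel (X i))"
      by (subst (1 2) nn_integral_distr) (auto intro: measurable_compose[OF ev])
  qed
  finally show ?thesis .
qed

text \<open>The block \<open>P\<close> and \<open>X i\<close> have a product joint law, so
  \<open>X i\<close> can be integrated out with the block held fixed. Here \<open>f\<close> takes
  the whole family; \<open>local\<close> says that it reads only the coordinates in
  \<open>P\<close>.\<close>

lemma (in prob_space) nn_integral_indep_fresh':
  assumes ind: "indep_vars (\<lambda>_. borel) X I" and P: "P \<subseteq> I" "i \<in> I" "i \<notin> P"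
    and f: "case_prod f \<in> borel_measurable (PiM P (\<lambda>_. borel) \<Otimes>\<^sub>M borel)"
    and local: "\<And>x y. (\<And>k. k \<in> P \<Longrightarrow> x k = y k) \<Longrightarrow> f x = f y"
    and D: "distr M borel (X i) = D"
  shows "(\<integral>\<^sup>+\<omega>. f (\<lambda>k. X k \<omega>) (X i \<omega>) \<partial>M) = (\<integral>\<^sup>+\<omega>. \<integral>\<^sup>+y. f (\<lambda>k. X k \<omega>) y \<partial>D \<partial>M)"
proof -
  have "f (restrict (\<lambda>k. X k \<omega>) P) = f (\<lambda>k. X k \<omega>)" for \<omega>
    by (rule local) simp
  thus ?thesis using nn_integral_indep_fresh[OF ind P f] by (simp add: D)
qed

section \<open>The LCFS network\<close>

text \<open>The Boolean separates interarrival times (\<open>True\<close>) from service times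
  (\<open>False\<close>), so that all variables form one independent family.\<close>

type_synonym idx = "bool \<times> nat \<times> nat"

definition arrivals :: "(idx \<Rightarrow> real) \<Rightarrow> nat \<Rightarrow> nat \<Rightarrow> real" where
  "arrivals x j k = x (True, j, k)"

definition services :: "(idx \<Rightarrow> real) \<Rightarrow> nat \<Rightarrow> nat \<Rightarrow> real" where
  "services x j k = x (False, j, k)"

text \<open>The endpoint \<open>c\<close> is excluded: an update generated exactly at
  \<open>t - x\<close> and delivered by time \<open>t\<close> still allows an age of
  \<open>x\<close>.\<close>

definition quiet :: "real \<Rightarrow> real \<Rightarrow> nat \<Rightarrow> nat \<Rightarrow> (idx \<Rightarrow> real) \<Rightarrow> bool" where
  "quiet c e j k x \<longleftrightarrow> \<not> (c < arr (arrivals x) j k \<and> arr (arrivals x) j k + services x j k \<le> e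
     \<and> delivered (arrivals x) (services x) j k)"

definition quiet_ind :: "real \<Rightarrow> real \<Rightarrow> real \<Rightarrow> real \<Rightarrow> nat \<Rightarrow> nat \<Rightarrow> (idx \<Rightarrow> real) \<Rightarrow> ennreal" where
  "quiet_ind c1 e1 c2 e2 j K x = of_bool (\<forall>k<K. quiet c1 e1 j k x \<and> quiet c2 e2 j k x)"

text \<open>The interarrival and service times of server \<open>j\<close> that determine its arrivals up to the
  \<open>K\<close>-th one and the fate of all updates before it.\<close>

definition past :: "nat \<Rightarrow> nat \<Rightarrow> idx set" where
  "past j K = {(b, i, k). i = j \<and> (if b then k \<le> K else k < K)}"

lemma arr_Suc: "arr a j (Suc k) = arr a j k + a j (Suc k)"
  by (simp add: arr_def)

lemma quiet_alt: "quiet c e j k x \<longleftrightarrow>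
   \<not> (x (False, j, k) < x (True, j, Suc k) \<and> c < arr (arrivals x) j k \<and> arr (arrivals x) j k
       + x (False, j, k) \<le> e)"
  unfolding quiet_def delivered_def arr_Suc by (auto simp: arrivals_def services_def)

lemma quiet_ind_Suc:
  "quiet_ind c1 e1 c2 e2 j (Suc K) x = quiet_ind c1 e1 c2 e2 j K x *
     undelivered_ind c1 e1 c2 e2 (arr (arrivals x) j K) (x (True, j, Suc K)) (x (False, j, K))"
  unfolding quiet_ind_def undelivered_ind_def quiet_alt less_Suc_eq by auto

lemma arr_cong_past:
  assumes "\<And>i. i \<in> past j K \<Longrightarrow> x i = y i" "k \<le> K"
  shows "arr (arrivals x) j k = arr (arrivals y) j k"
  unfolding arr_def arrivals_def using assms by (intro sum.cong) (auto simp: past_def)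

lemma quiet_ind_cong_past:
  assumes "\<And>i. i \<in> past j K \<Longrightarrow> x i = y i"
  shows "quiet_ind c1 e1 c2 e2 j K x = quiet_ind c1 e1 c2 e2 j K y"
proof -
  have "quiet c e j k x = quiet c e j k y" if "k < K" for k c e
    using arr_cong_past[of j K x y k] assms that by (simp add: quiet_alt past_def)
  thus ?thesis by (simp add: quiet_ind_def)
qed

lemma measurable_arr_past:
  assumes "past j K \<subseteq> L" "k \<le> K"
  shows "(\<lambda>x. arr (arrivals x) j k) \<in> borel_measurable (PiM L (\<lambda>_. borel))"
proof -
  have "(\<lambda>x. x (True, j, l)) \<in> borel_measurable (PiM L (\<lambda>_. borel))" if "l \<le> k" for l
    using assms that by (intro measurable_component_singleton) (auto simp: past_def)
  thus ?thesis unfolding arr_def arrivals_def by (intro borel_measurable_sum) auto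
qed

lemma measurable_quiet:
  assumes "past j (Suc k) \<subseteq> L"
  shows "Measurable.pred (PiM L (\<lambda>_. borel)) (quiet c e j k)"
proof -
  have [measurable]: "(\<lambda>x. arr (arrivals x) j k) \<in> borel_measurable (PiM L (\<lambda>_. borel))"
    by (rule measurable_arr_past[OF assms]) simp
  have [measurable]: "(\<lambda>x. x (True, j, Suc k)) \<in> borel_measurable (PiM L (\<lambda>_. borel))"
    "(\<lambda>x. x (False, j, k)) \<in> borel_measurable (PiM L (\<lambda>_. borel))"
    using assms by (intro measurable_component_singleton; auto simp: past_def)+
  show ?thesis unfolding quiet_alt[abs_def] by measurable
qed

lemma past_mono: "K \<le> K' \<Longrightarrow> past j K \<subseteq> past j K'"
  by (auto simp: past_def split: if_splits)

lemma measurable_quiet_ind: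
  assumes "past j K \<subseteq> L"
  shows "quiet_ind c1 e1 c2 e2 j K \<in> borel_measurable (PiM L (\<lambda>_. borel))"
proof -
  have "Measurable.pred (PiM L (\<lambda>_. borel)) (quiet c e j k)" if "k < K" for c e k
    using past_mono[of "Suc k" K j] assms that by (intro measurable_quiet) auto
  hence [measurable]: "Measurable.pred (PiM L (\<lambda>_. borel)) (\<lambda>x. \<forall>k\<in>{..<K}. quiet c1 e1 j k x
      \<and> quiet c2 e2 j k x)"
    by (intro pred_intros_finite pred_intros_logic) auto
  have "quiet_ind c1 e1 c2 e2 j K = (\<lambda>x. if \<forall>k\<in>{..<K}. quiet c1 e1 j k x
      \<and> quiet c2 e2 j k x then 1 else 0)"
    by (auto simp: quiet_ind_def fun_eq_iff)
  thus ?thesis by simp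
qed

text \<open>The Laplace transform at 1. Being below 1, it makes the mean of \<open>exp\<close> of
  the negated arrival time decay geometrically in the number of arrivals, which is how the arrivals
  are shown to leave every window.\<close>

lemma nn_integral_expo_exp:
  assumes "l > 0"
  shows "(\<integral>\<^sup>+a. ennreal (exp (- a)) \<partial>expo l) = ennreal (l / (l + 1))"
proof -
  define m where "m = l + 1"
  have m: "m > 0" using assms by (simp add: m_def)
  have lim: "((\<lambda>x. - (l / m) * exp (- m * x)) \<longlongrightarrow> 0) at_top"
    using m by (intro tendsto_mult_right_zero filterlim_compose[OF exp_at_bot]
      filterlim_tendsto_neg_mult_at_bot[OF tendsto_const]) (auto simp: filterlim_ident)
  have "(\<integral>\<^sup>+a. ennreal (exp (- a)) \<partial>expo l) = (\<integral>\<^sup>+x. ennreal (l * exp (- m * x))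
      * indicator {0..} x \<partial>lborel)"
    using assms by (subst nn_integral_expo)
      (auto simp flip: ennreal_mult exp_add simp: algebra_simps m_def intro!: nn_integral_cong)
  also have "\<dots> = ennreal (0 - (- (l / m) * exp (- m * 0)))"
    using assms m lim by (intro nn_integral_FTC_atLeast) (auto intro!: derivative_eq_intros)
  finally show ?thesis by (simp add: m_def)
qed

section \<open>The martingale along the arrivals of one server\<close>

locale lcfs_network = prob_space M for M :: "'w measure" +
  fixes n :: nat and lam mu :: real and A S :: "nat \<Rightarrow> nat \<Rightarrow> 'w \<Rightarrow> real"
  assumes n: "n \<ge> 1" and lam: "lam > 0" and mu: "mu > 0"
    and distributed_A: "\<And>j k. j < n \<Longrightarrow> distributed M lborel (A j k) (exponential_density lam)"
    and distributed_S: "\<And>j k. j < n \<Longrightarrow> distributed M lborel (S j k) (exponential_density mu)"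
    and indep: "indep_vars (\<lambda>_. borel) (\<lambda>(b, j, k). if b then A j k else S j k) {(b, j, k). j < n}"
begin

definition X :: "idx \<Rightarrow> 'w \<Rightarrow> real" where
  "X = (\<lambda>(b, j, k). if b then A j k else S j k)"

definition path :: "'w \<Rightarrow> idx \<Rightarrow> real" where
  "path \<omega> = (\<lambda>i. X i \<omega>)"

lemma indep_X: "indep_vars (\<lambda>_. borel) X {(b, j, k). j < n}"
  unfolding X_def by (rule indep)

lemma measurable_X [measurable]: "j < n \<Longrightarrow> X (b, j, k) \<in> borel_measurable M"
  using indep_X by (auto simp: indep_vars_def)

lemma distr_X:
  assumes "j < n"
  shows "distr M borel (X (True, j, k)) = expo lam" "distr M borel (X (False, j, k)) = expo mu"
proof -
  have "distr M borel f = distr M lborel f" for f :: "'w \<Rightarrow> real" by (rule distr_cong) auto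
  thus "distr M borel (X (True, j, k)) = expo lam" "distr M borel (X (False, j, k)) = expo mu"
    using distributed_A[OF assms, of k] distributed_S[OF assms, of k]
        by (auto simp: X_def distributed_def)
qed

lemma arrivals_path [simp]: "arrivals (path \<omega>) = (\<lambda>j k. A j k \<omega>)"
  and services_path [simp]: "services (path \<omega>) = (\<lambda>j k. S j k \<omega>)"
  by (auto simp: arrivals_def services_def path_def X_def fun_eq_iff)

lemma past_subset: "j < n \<Longrightarrow> past j K \<subseteq> {(b, j, k). j < n}"
  by (auto simp: past_def)

text \<open>The fate of update \<open>K\<close> depends on its service time and on the next
  interarrival time, both absent from \<open>past j K\<close>. They are integrated out against this
  past, and \<open>cond_quiet_step\<close> gives back the expression for \<open>K\<close>.\<close>

lemma nn_integral_quiet_ind: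
  assumes j: "j < n" and w: "0 \<le> c1" "c1 \<le> e1" "e1 \<le> c2" "c2 \<le> e2"
  shows "(\<integral>\<^sup>+\<omega>. quiet_ind c1 e1 c2 e2 j K (path \<omega>) *
       (cond_quiet lam mu c1 e1 (arr (arrivals (path \<omega>)) j K)
           * cond_quiet lam mu c2 e2 (arr (arrivals (path \<omega>)) j K)) \<partial>M)
     = ennreal (stale lam mu (e1 - c1)) * ennreal (stale lam mu (e2 - c2))"
proof (induction K)
  let ?h1 = "cond_quiet lam mu c1 e1" and ?h2 = "cond_quiet lam mu c2 e2"
  interpret E: prob_space "expo mu" by (rule prob_space_exponential_density[OF mu])
  interpret F: prob_space "expo lam" by (rule prob_space_exponential_density[OF lam])
  case 0
  have "(\<integral>\<^sup>+\<omega>. quiet_ind c1 e1 c2 e2 j 0 (path \<omega>) * (?h1 (arr (arrivals (path \<omega>)) j 0)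
      * ?h2 (arr (arrivals (path \<omega>)) j 0)) \<partial>M)
    = (\<integral>\<^sup>+\<omega>. ?h1 (X (True, j, 0) \<omega>) * ?h2 (X (True, j, 0) \<omega>) \<partial>M)"
    by (simp add: quiet_ind_def arr_def X_def)
  also have "\<dots> = (\<integral>\<^sup>+a. ?h1 a * ?h2 a \<partial>expo lam)"
    unfolding distr_X(1)[OF j, of 0, symmetric] using j by (subst nn_integral_distr) auto
  \<comment> \<open>A fictitious arrival at time 0 has no effect on the windows, as
    \<open>0 \<le> c1\<close>; it reduces the base case to the same one-step identity.\<close>
  also have "\<dots> = (\<integral>\<^sup>+a. (\<integral>\<^sup>+s. undelivered_ind c1 e1 c2 e2 0 a s \<partial>expo mu) * (?h1 (0
      + a) * ?h2 (0 + a)) \<partial>expo lam)"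
    using w E.emeasure_space_1 by (simp add: undelivered_ind_def)
  also have "\<dots> = ?h1 0 * ?h2 0"
    by (rule cond_quiet_step) (use w lam mu in auto)
  finally show ?case using w by (simp add: cond_quiet_def)
next
  let ?h1 = "cond_quiet lam mu c1 e1" and ?h2 = "cond_quiet lam mu c2 e2"
  interpret E: prob_space "expo mu" by (rule prob_space_exponential_density[OF mu])
  interpret F: prob_space "expo lam" by (rule prob_space_exponential_density[OF lam])
  case (Suc K)
  \<comment> \<open>The service time is integrated out first, so the block held fixed also contains
    the next interarrival time, with which it is compared.\<close>
  define L where "L = insert (True, j, Suc K) (past j K)"
  let ?U = "undelivered_ind c1 e1 c2 e2"
  let ?q = "quiet_ind c1 e1 c2 e2 j K"
  let ?r = "\<lambda>x. arr (arrivals x) j K"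
  define D where "D r a = (\<integral>\<^sup>+s. ?U r a s \<partial>expo mu)" for r a
  have U [measurable]: "(\<lambda>(r, a, s). ?U r a s) \<in> borel_measurable (borel \<Otimes>\<^sub>M borel \<Otimes>\<^sub>M borel)"
  proof -
    have "(\<lambda>(r, a, s). ?U r a s) = (\<lambda>(r, a, s). if \<not> (s < a \<and> (c1 < r \<and> r + s \<le>
        e1 \<or> c2 < r \<and> r + s \<le> e2)) then 1 else 0)"
      by (auto simp: undelivered_ind_def fun_eq_iff)
    also have "\<dots> \<in> borel_measurable (borel \<Otimes>\<^sub>M borel \<Otimes>\<^sub>M borel)" by measurable
    finally show ?thesis .
  qed
  have [measurable]: "(\<lambda>z. D (fst z) (snd z)) \<in> borel_measurable (borel \<Otimes>\<^sub>M borel)"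
  proof -
    have "(\<lambda>z::(real \<times> real) \<times> real. (fst (fst z), snd (fst z), snd z))
        \<in> (borel \<Otimes>\<^sub>M borel) \<Otimes>\<^sub>M expo mu \<rightarrow>\<^sub>M borel \<Otimes>\<^sub>M borel \<Otimes>\<^sub>M borel"
      by measurable
    from measurable_compose[OF this U] have "(\<lambda>(z, s). ?U (fst z) (snd z) s)
        \<in> borel_measurable ((borel \<Otimes>\<^sub>M borel) \<Otimes>\<^sub>M expo mu)"
      by (simp add: case_prod_beta)
    from E.borel_measurable_nn_integral[OF this] show ?thesis by (simp add: D_def)
  qed
  have LI: "L \<subseteq> {(b, j, k). j < n}" using j by (auto simp: L_def past_def)
  have qL [measurable]: "?q \<in> borel_measurable (PiM L (\<lambda>_. borel))" "?q
      \<in> borel_measurable (PiM (past j K) (\<lambda>_. borel))"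
    by (rule measurable_quiet_ind; auto simp: L_def)+
  have rL [measurable]: "?r \<in> borel_measurable (PiM L (\<lambda>_. borel))" "?r
      \<in> borel_measurable (PiM (past j K) (\<lambda>_. borel))"
    by (rule measurable_arr_past[of j K]; auto simp: L_def)+
  have aL: "(\<lambda>x. x (True, j, Suc K)) \<in> borel_measurable (PiM L (\<lambda>_. borel))"
    by (rule measurable_component_singleton) (simp add: L_def)
  define f where "f x s = ?q x * ?U (?r x) (x (True, j, Suc K)) s *
     (?h1 (?r x + x (True, j, Suc K)) * ?h2 (?r x + x (True, j, Suc K)))" for x s
  define g where "g x a = ?q x * (D (?r x) a * (?h1 (?r x + a) * ?h2 (?r x + a)))" for x a
  have f_meas: "case_prod f \<in> borel_measurable (PiM L (\<lambda>_. borel) \<Otimes>\<^sub>M borel)"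
  proof -
    note aL [measurable]
    have "(\<lambda>z. (?r (fst z), fst z (True, j, Suc K), snd z))
        \<in> PiM L (\<lambda>_. borel) \<Otimes>\<^sub>M borel \<rightarrow>\<^sub>M borel \<Otimes>\<^sub>M borel \<Otimes>\<^sub>M borel"
      by measurable
    from measurable_compose[OF this U] have [measurable]: "(\<lambda>z. ?U (?r (fst z)) (fst z
        (True, j, Suc K)) (snd z)) \<in> borel_measurable (PiM L (\<lambda>_. borel) \<Otimes>\<^sub>M borel)"
      by simp
    show ?thesis unfolding f_def case_prod_beta by measurable
  qed
  have g_meas: "case_prod g \<in> borel_measurable (PiM (past j K) (\<lambda>_. borel) \<Otimes>\<^sub>M borel)"
  proof -
    have "(\<lambda>z. (?r (fst z), snd z)) \<in> PiM (past j K) (\<lambda>_. borel) \<Otimes>\<^sub>M borel \<rightarrow>\<^sub>M borel \<Otimes>\<^sub>M borel"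
      by measurable
    from measurable_compose[OF this \<open>(\<lambda>z. D (fst z) (snd z)) \<in> _\<close>]
    have [measurable]: "(\<lambda>z. D (?r (fst z)) (snd z))
        \<in> borel_measurable (PiM (past j K) (\<lambda>_. borel) \<Otimes>\<^sub>M borel)"
      by simp
    show ?thesis unfolding g_def case_prod_beta by measurable
  qed
  have "(\<integral>\<^sup>+\<omega>. quiet_ind c1 e1 c2 e2 j (Suc K) (path \<omega>)
      * (?h1 (arr (arrivals (path \<omega>)) j (Suc K)) * ?h2 (arr (arrivals (path \<omega>)) j (Suc K))) \<partial>M)
    = (\<integral>\<^sup>+\<omega>. f (path \<omega>) (X (False, j, K) \<omega>) \<partial>M)"
    unfolding f_def quiet_ind_Suc arr_Suc by (simp only: arrivals_def path_def)
  also have "\<dots> = (\<integral>\<^sup>+\<omega>. \<integral>\<^sup>+s. f (path \<omega>) s \<partial>expo mu \<partial>M)"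
    unfolding path_def
  proof (rule nn_integral_indep_fresh'[OF indep_X LI _ _ f_meas _ distr_X(2)[OF j]])
    show "(False, j, K) \<in> {(b, j, k). j < n}" using j by simp
    show "(False, j, K) \<notin> L" by (auto simp: L_def past_def)
    fix x y assume *: "\<And>k. k \<in> L \<Longrightarrow> x k = (y k :: real)"
    hence "?q x = ?q y" "?r x = ?r y" by (auto intro!: quiet_ind_cong_past arr_cong_past simp:
        L_def)
    thus "f x = f y" using *[of "(True, j, Suc K)"] by (simp add: f_def fun_eq_iff L_def)
  qed
  also have "\<dots> = (\<integral>\<^sup>+\<omega>. g (path \<omega>) (X (True, j, Suc K) \<omega>) \<partial>M)"
  proof (intro nn_integral_cong)
    fix \<omega>
    have [measurable]: "(\<lambda>s. ?U r a s) \<in> borel_measurable (expo mu)" for r a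
      using measurable_compose[OF _ U, of "\<lambda>s. (r, a, s)" "expo mu"] by simp
    show "(\<integral>\<^sup>+s. f (path \<omega>) s \<partial>expo mu) = g (path \<omega>) (X (True, j, Suc K) \<omega>)"
      by (simp add: f_def g_def D_def nn_integral_multc nn_integral_cmult mult_ac path_def)
  qed
  also have "\<dots> = (\<integral>\<^sup>+\<omega>. \<integral>\<^sup>+a. g (path \<omega>) a \<partial>expo lam \<partial>M)"
    unfolding path_def
  proof (rule nn_integral_indep_fresh'[OF indep_X past_subset[OF j] _ _ g_meas _ distr_X(1)[OF j]])
    show "(True, j, Suc K) \<in> {(b, j, k). j < n}" using j by simp
    show "(True, j, Suc K) \<notin> past j K" by (auto simp: past_def)
    fix x y assume *: "\<And>k. k \<in> past j K \<Longrightarrow> x k = (y k :: real)"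
    hence "?q x = ?q y" "?r x = ?r y" by (auto intro!: quiet_ind_cong_past arr_cong_past)
    thus "g x = g y" by (simp add: g_def fun_eq_iff)
  qed
  also have "\<dots> = (\<integral>\<^sup>+\<omega>. ?q (path \<omega>) * (?h1 (?r (path \<omega>)) * ?h2 (?r (path \<omega>))) \<partial>M)"
  proof (intro nn_integral_cong)
    fix \<omega>
    have [measurable]: "(\<lambda>a. D r a) \<in> borel_measurable (expo lam)" for r
      using measurable_compose[OF _ \<open>(\<lambda>z. D (fst z) (snd z))
          \<in> _\<close>, of "\<lambda>s. (r, s)" "expo lam"] by simp
    have "(\<integral>\<^sup>+a. g (path \<omega>) a \<partial>expo lam) = ?q (path \<omega>) * (\<integral>\<^sup>+a. D (?r (path \<omega>)) a
        * (?h1 (?r (path \<omega>) + a) * ?h2 (?r (path \<omega>) + a)) \<partial>expo lam)"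
      unfolding g_def by (rule nn_integral_cmult) measurable
    thus "(\<integral>\<^sup>+a. g (path \<omega>) a \<partial>expo lam) = ?q (path \<omega>) * (?h1 (?r (path \<omega>)) * ?h2 (?r (path \<omega>)))"
      unfolding D_def using cond_quiet_step[OF lam mu w(2-4)] by simp
  qed
  also note Suc.IH
  finally show ?case .
qed

lemma measurable_arr:
  assumes "j < n"
  shows "(\<lambda>\<omega>. arr (arrivals (path \<omega>)) j K) \<in> borel_measurable M"
  using measurable_X[OF assms] unfolding arr_def arrivals_def path_def by measurable

lemma nn_integral_exp_arr:
  assumes j: "j < n"
  shows "(\<integral>\<^sup>+\<omega>. ennreal (exp (- arr (arrivals (path \<omega>)) j K)) \<partial>M) =
      ennreal (lam / (lam + 1)) ^ Suc K"
proof (induction K)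
  case 0
  have "(\<integral>\<^sup>+\<omega>. ennreal (exp (- arr (arrivals (path \<omega>)) j 0)) \<partial>M) =
      (\<integral>\<^sup>+\<omega>. ennreal (exp (- X (True, j, 0) \<omega>)) \<partial>M)"
    by (simp add: arr_def X_def)
  also have "\<dots> = (\<integral>\<^sup>+a. ennreal (exp (- a)) \<partial>expo lam)"
    unfolding distr_X(1)[OF j, of 0, symmetric] using j by (subst nn_integral_distr) auto
  finally show ?case using lam by (simp add: nn_integral_expo_exp)
next
  case (Suc K)
  let ?r = "\<lambda>x. arr (arrivals x) j K"
  define f where "f x a = ennreal (exp (- ?r x))
      * ennreal (exp (- a))" for x :: "idx \<Rightarrow> real" and a :: real
  have [measurable]: "?r \<in> borel_measurable (PiM (past j K) (\<lambda>_. borel))"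
    by (rule measurable_arr_past[of j K]) auto
  have "(\<integral>\<^sup>+\<omega>. ennreal (exp (- arr (arrivals (path \<omega>)) j (Suc K))) \<partial>M) =
      (\<integral>\<^sup>+\<omega>. f (path \<omega>) (X (True, j, Suc K) \<omega>) \<partial>M)"
    unfolding f_def arr_Suc by (simp add: X_def exp_add[symmetric] ennreal_mult[symmetric])
  also have "\<dots> = (\<integral>\<^sup>+\<omega>. \<integral>\<^sup>+a. f (path \<omega>) a \<partial>expo lam \<partial>M)"
    unfolding path_def
  proof (rule nn_integral_indep_fresh'[OF indep_X past_subset[OF j] _ _ _ _ distr_X(1)[OF j]])
    show "(True, j, Suc K) \<in> {(b, j, k). j < n}" using j by simp
    show "(True, j, Suc K) \<notin> past j K" by (auto simp: past_def)
    show "case_prod f \<in> borel_measurable (PiM (past j K) (\<lambda>_. borel) \<Otimes>\<^sub>M borel)"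
      unfolding f_def case_prod_beta by measurable
    fix x y assume *: "\<And>k. k \<in> past j K \<Longrightarrow> x k = (y k :: real)"
    hence "?r x = ?r y" by (auto intro!: arr_cong_past)
    thus "f x = f y" by (simp add: f_def fun_eq_iff)
  qed
  also have "\<dots> = (\<integral>\<^sup>+\<omega>. ennreal (exp (- ?r (path \<omega>))) * ennreal (lam / (lam + 1)) \<partial>M)"
    using lam by (simp add: f_def nn_integral_cmult nn_integral_expo_exp)
  also have "\<dots> = ennreal (lam / (lam + 1)) ^ Suc K * ennreal (lam / (lam + 1))"
    by (subst nn_integral_multc) (use measurable_arr[OF j, of K] Suc.IH in simp_all)
  finally show ?case by (simp add: mult.commute)
qed

end

section \<open>Limit over all arrivals and product over the servers\<close>

lemma cond_quiet_le_1:
  assumes "lam > 0" "mu > 0" "c \<le> e"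
  shows "cond_quiet lam mu c e r \<le> 1"
  using assms stale_le_1[of lam mu "e - c"] by (auto simp: cond_quiet_def)

lemma cond_quiet_eq_1: "c \<le> e \<Longrightarrow> e < r \<Longrightarrow> cond_quiet lam mu c e r = 1"
  by (simp add: cond_quiet_def)

context lcfs_network
begin

lemma measurable_quiet_path [measurable]:
  assumes "j < n"
  shows "Measurable.pred (borel \<Otimes>\<^sub>M borel \<Otimes>\<^sub>M M) (\<lambda>(c, e, \<omega>). quiet c e j k (path \<omega>))"
proof -
  define r where "r = (\<lambda>\<omega>. arr (arrivals (path \<omega>)) j k)"
  define s where "s = X (False, j, k)"
  define a where "a = X (True, j, Suc k)"
  have [measurable]: "r \<in> borel_measurable M" "s \<in> borel_measurable M" "a \<in> borel_measurable M"
    unfolding r_def s_def a_def using assms by (auto intro: measurable_arr[simplified])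
  have "(\<lambda>(c, e, \<omega>). quiet c e j k (path \<omega>)) = (\<lambda>z. \<not> (s (snd (snd z)) < a (snd (snd z)) \<and>
      fst z < r (snd (snd z)) \<and> r (snd (snd z)) + s (snd (snd z)) \<le> fst (snd z)))"
    by (auto simp: quiet_alt path_def r_def s_def a_def fun_eq_iff)
  also have "Measurable.pred (borel \<Otimes>\<^sub>M borel \<Otimes>\<^sub>M M) \<dots>" by measurable
  finally show ?thesis .
qed

lemma events_quiet:
  assumes "j < n"
  shows "{\<omega>\<in>space M. quiet c e j k (path \<omega>)} \<in> events"
proof -
  have "(\<lambda>\<omega>. (c, e, \<omega>)) \<in> M \<rightarrow>\<^sub>M borel \<Otimes>\<^sub>M borel \<Otimes>\<^sub>M M" by measurable
  from measurable_compose[OF this measurable_quiet_path[OF assms]] show ?thesis by simp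
qed

text \<open>The event is the decreasing limit of \<open>G K\<close>, whose probability is squeezed:
  \<open>?h \<le> 1\<close> bounds the martingale by the indicator, and the indicator exceeds it
  only while the \<open>K\<close>-th arrival is at most \<open>e2\<close>.\<close>

lemma prob_quiet:
  assumes j: "j < n" and w: "0 \<le> c1" "c1 \<le> e1" "e1 \<le> c2" "c2 \<le> e2"
  shows "prob {\<omega>\<in>space M. \<forall>k. quiet c1 e1 j k (path \<omega>) \<and> quiet c2 e2 j k (path \<omega>)}
    = stale lam mu (e1 - c1) * stale lam mu (e2 - c2)" (is "prob ?G = ?q")
proof -
  define G where "G K = {\<omega>\<in>space M. \<forall>k<K. quiet c1 e1 j k (path \<omega>)
      \<and> quiet c2 e2 j k (path \<omega>)}" for K
  define th where "th = lam / (lam + 1)"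
  have th: "0 \<le> th" "th < 1" using lam by (auto simp: th_def)
  have q0: "0 \<le> ?q" using w lam by (simp add: stale_nonneg)
  have G [measurable]: "G K \<in> events" for K
  proof -
    have "{\<omega>\<in>space M. \<forall>k\<in>{..<K}. quiet c1 e1 j k (path \<omega>) \<and> quiet c2 e2 j k (path \<omega>)} \<in> events"
      by (intro sets.sets_Collect_finite_All sets.sets_Collect_conj events_quiet j finite_lessThan)
    thus ?thesis unfolding G_def lessThan_iff[symmetric] by (simp only: Ball_def)
  qed
  have "decseq G" unfolding decseq_def G_def by (auto dest: less_le_trans)
  hence lim: "(\<lambda>K. prob (G K)) \<longlonglongrightarrow> prob (\<Inter>K. G K)"
    using G by (intro finite_Lim_measure_decseq) blast
  have INT: "(\<Inter>K. G K) = ?G"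
  proof (intro equalityI subsetI)
    fix \<omega> assume "\<omega> \<in> (\<Inter>K. G K)"
    hence "\<omega> \<in> G (Suc k)" for k by blast
    thus "\<omega> \<in> ?G" unfolding G_def using lessI by blast
  qed (simp add: G_def)
  let ?h = "\<lambda>r. cond_quiet lam mu c1 e1 r * cond_quiet lam mu c2 e2 r"
  let ?r = "\<lambda>K \<omega>. arr (arrivals (path \<omega>)) j K"
  let ?I = "\<lambda>K \<omega>. quiet_ind c1 e1 c2 e2 j K (path \<omega>)"
  have r [measurable]: "?r K \<in> borel_measurable M" for K by (rule measurable_arr[OF j])
  have I: "?I K \<omega> = indicator (G K) \<omega>" if "\<omega> \<in> space M" for K \<omega>
    using that by (auto simp: quiet_ind_def G_def split: split_indicator)
  have mart: "(\<integral>\<^sup>+\<omega>. indicator (G K) \<omega> * ?h (?r K \<omega>) \<partial>M) = ennreal ?q" for K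
  proof -
    have "(\<integral>\<^sup>+\<omega>. indicator (G K) \<omega> * ?h (?r K \<omega>) \<partial>M) = (\<integral>\<^sup>+\<omega>. ?I K \<omega> * ?h (?r K \<omega>) \<partial>M)"
      by (intro nn_integral_cong) (simp only: I)
    also have "\<dots> = ennreal ?q"
      using nn_integral_quiet_ind[OF j w, of K] w lam by (simp add: stale_nonneg ennreal_mult)
    finally show ?thesis .
  qed
  have lower: "?q \<le> prob (G K)" for K
  proof -
    have "ennreal ?q \<le> (\<integral>\<^sup>+\<omega>. indicator (G K) \<omega> \<partial>M)"
      unfolding mart[of K, symmetric]
    proof (intro nn_integral_mono)
      fix \<omega>
      have "?h (?r K \<omega>) \<le> 1 * 1" by (intro mult_mono cond_quiet_le_1 lam mu w) auto
      thus "indicator (G K) \<omega> * ?h (?r K \<omega>) \<le> indicator (G K) \<omega>" by (auto split: split_indicator)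
    qed
    thus ?thesis by (simp add: emeasure_eq_measure)
  qed
  \<comment> \<open>Markov inequality in exponential form: \<open>exp (e2 - ?r K \<omega>)\<close>
    is at least 1 while the arrival is at most \<open>e2\<close>, and beyond \<open>e2\<close> both
    windows are over and \<open>?h\<close> is 1.\<close>
  have upper: "prob (G K) \<le> ?q + exp e2 * th ^ Suc K" for K
  proof -
    have "ennreal (prob (G K)) = (\<integral>\<^sup>+\<omega>. indicator (G K) \<omega> \<partial>M)" by (simp add: emeasure_eq_measure)
    also have "\<dots> \<le> (\<integral>\<^sup>+\<omega>. indicator (G K) \<omega> * ?h (?r K \<omega>)
        + ennreal (exp e2) * ennreal (exp (- ?r K \<omega>)) \<partial>M)"
    proof (intro nn_integral_mono)
      fix \<omega>
      show "indicator (G K) \<omega> \<le> indicator (G K) \<omega> * ?h (?r K \<omega>)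
          + ennreal (exp e2) * ennreal (exp (- ?r K \<omega>))"
      proof (cases "?r K \<omega> \<le> e2")
        case True
        hence "1 \<le> exp (e2 - ?r K \<omega>)" by simp
        also have "exp (e2 - ?r K \<omega>) = exp e2 * exp (- ?r K \<omega>)"
            by (simp add: exp_diff exp_minus field_simps)
        finally have "1 \<le> ennreal (exp e2) * ennreal (exp (- ?r K \<omega>))"
          by (subst ennreal_mult[symmetric]) auto
        hence "indicator (G K) \<omega> \<le> ennreal (exp e2) * ennreal (exp (- ?r K \<omega>))"
          by (auto split: split_indicator intro: order_trans)
        thus ?thesis by (rule add_increasing[OF zero_le])
      next
        case False
        hence "?h (?r K \<omega>) = 1" using w by (simp add: cond_quiet_eq_1)
        thus ?thesis by simp
      qed
    qed
    also have "\<dots> = ennreal ?q + ennreal (exp e2) * ennreal th ^ Suc K"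
    proof -
      have "(\<integral>\<^sup>+\<omega>. ennreal (exp e2) * ennreal (exp (- ?r K \<omega>)) \<partial>M) =
          ennreal (exp e2) * ennreal th ^ Suc K"
        unfolding th_def nn_integral_exp_arr[OF j, symmetric] by (rule nn_integral_cmult) measurable
      moreover have "(\<integral>\<^sup>+\<omega>. indicator (G K) \<omega> * ?h (?r K \<omega>)
          + ennreal (exp e2) * ennreal (exp (- ?r K \<omega>)) \<partial>M) =
        (\<integral>\<^sup>+\<omega>. indicator (G K) \<omega> * ?h (?r K \<omega>) \<partial>M) + (\<integral>\<^sup>+\<omega>. ennreal (exp e2)
            * ennreal (exp (- ?r K \<omega>)) \<partial>M)"
        by (rule nn_integral_add) measurable
      ultimately show ?thesis by (simp only: mart)
    qed
    also have "\<dots> = ennreal (?q + exp e2 * th ^ Suc K)"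
      using q0 th by (simp add: ennreal_power ennreal_mult del: power_Suc)
    finally show ?thesis using q0 th by (simp add: ennreal_le_iff del: ennreal_plus power_Suc)
  qed
  have "(\<lambda>K. ?q + exp e2 * th ^ Suc K) \<longlonglongrightarrow> ?q + exp e2 * 0"
    by (intro tendsto_intros LIMSEQ_Suc[OF LIMSEQ_realpow_zero]) (use th in auto)
  hence up: "(\<lambda>K. ?q + exp e2 * th ^ Suc K) \<longlonglongrightarrow> ?q" by simp
  have "(\<lambda>K. prob (G K)) \<longlonglongrightarrow> ?q"
    by (rule tendsto_sandwich[OF _ _ tendsto_const up]) (use lower upper in auto)
  from LIMSEQ_unique[OF lim this] show ?thesis unfolding INT .
qed

lemma prob_all_quiet:
  assumes w: "0 \<le> c1" "c1 \<le> e1" "e1 \<le> c2" "c2 \<le> e2"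
  shows "prob {\<omega>\<in>space M. \<forall>j<n. \<forall>k. quiet c1 e1 j k (path \<omega>) \<and> quiet c2 e2 j k (path \<omega>)}
    = stale lam mu (e1 - c1) ^ n * stale lam mu (e2 - c2) ^ n"
proof -
  define N :: "nat \<Rightarrow> idx set" where "N j = {(b, i, k). i = j}" for j
  define E where "E j = {x\<in>space (PiM (N j) (\<lambda>_. borel :: real measure)). \<forall>k. quiet c1 e1 j k x
      \<and> quiet c2 e2 j k x}" for j
  define Y where "Y j \<omega> = restrict (path \<omega>) (N j)" for j \<omega>
  have ind: "indep_vars (\<lambda>j. PiM (N j) (\<lambda>_. borel)) Y {..<n}"
    unfolding Y_def path_def
    by (rule indep_vars_restrict[OF indep_X]) (auto simp: N_def disjoint_family_on_def)
  have E: "E j \<in> sets (PiM (N j) (\<lambda>_. borel))" for j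
  proof -
    have [measurable]: "Measurable.pred (PiM (N j) (\<lambda>_. borel)) (quiet c e j k)" for c e k
      by (rule measurable_quiet) (auto simp: N_def past_def)
    show ?thesis unfolding E_def by measurable
  qed
  have pre: "Y j -` E j \<inter> space M = {\<omega>\<in>space M. \<forall>k. quiet c1 e1 j k (path \<omega>)
      \<and> quiet c2 e2 j k (path \<omega>)}"
    if "j < n" for j
  proof -
    have "quiet c e j k (Y j \<omega>) = quiet c e j k (path \<omega>)" for c e k \<omega>
      unfolding quiet_alt arr_def arrivals_def Y_def by (simp add: N_def)
    moreover have "Y j \<omega> \<in> space (PiM (N j) (\<lambda>_. borel))" for \<omega>
      by (auto simp: Y_def space_PiM)
    ultimately show ?thesis by (auto simp: E_def)
  qed
  have "{\<omega>\<in>space M. \<forall>j<n. \<forall>k. quiet c1 e1 j k (path \<omega>) \<and> quiet c2 e2 j k (path \<omega>)} =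
      (\<Inter>j\<in>{..<n}. Y j -` E j \<inter> space M)"
  proof (intro equalityI subsetI)
    fix \<omega> assume \<omega>: "\<omega> \<in> (\<Inter>j\<in>{..<n}. Y j -` E j \<inter> space M)"
    \<comment> \<open>Some server exists, so the intersection is not over an empty family and lies
      in \<open>space M\<close>.\<close>
    have "0 \<in> {..<n}" using n by simp
    hence "\<omega> \<in> space M" using \<omega> by blast
    thus "\<omega> \<in> {\<omega>\<in>space M. \<forall>j<n. \<forall>k. quiet c1 e1 j k (path \<omega>) \<and> quiet c2 e2 j k (path \<omega>)}"
      using \<omega> by (simp add: pre)
  qed (simp add: pre)
  also have "prob \<dots> = (\<Prod>j<n. prob (Y j -` E j \<inter> space M))"
    using n by (intro indep_varsD_finite[OF ind] E) (auto simp: lessThan_empty_iff)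
  also have "\<dots> = (\<Prod>j<n. stale lam mu (e1 - c1) * stale lam mu (e2 - c2))"
    using prob_quiet[OF _ w] by (intro prod.cong) (auto simp: pre)
  finally show ?thesis by (simp add: power_mult_distrib)
qed

section \<open>From quiet windows to the age\<close>

definition B :: "real \<Rightarrow> real \<Rightarrow> 'w \<Rightarrow> bool" where
  "B x t \<omega> \<longleftrightarrow> (\<forall>j<n. \<forall>k. quiet (t - x) t j k (path \<omega>))"

lemma AE_S_nonneg: "AE \<omega> in M. \<forall>j<n. \<forall>k. S j k \<omega> \<ge> 0"
proof -
  have "AE \<omega> in M. S j k \<omega> \<ge> 0" if j: "j < n" for j k
  proof -
    have "AE x in distr M borel (X (False, j, k)). x \<ge> 0"
      unfolding distr_X(2)[OF j] by (rule AE_expo_nonneg)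
    hence "AE \<omega> in M. X (False, j, k) \<omega> \<ge> 0"
      by (subst (asm) AE_distr_iff) (use j in auto)
    thus ?thesis by (simp add: X_def)
  qed
  hence "AE \<omega> in M. \<forall>j\<in>{..<n}. \<forall>k. S j k \<omega> \<ge> 0"
    by (intro AE_finite_allI) (auto simp: AE_all_countable)
  thus ?thesis by eventually_elim auto
qed

lemma pred_B: "Measurable.pred (borel \<Otimes>\<^sub>M borel \<Otimes>\<^sub>M M) (\<lambda>(x, t, \<omega>). B x t \<omega>)"
proof -
  have m: "(\<lambda>z :: real \<times> real \<times> 'w. (fst (snd z) - fst z, fst (snd z), snd (snd z)))
      \<in> borel \<Otimes>\<^sub>M borel \<Otimes>\<^sub>M M \<rightarrow>\<^sub>M borel \<Otimes>\<^sub>M borel \<Otimes>\<^sub>M M"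
    by measurable
  let ?N = "borel \<Otimes>\<^sub>M borel \<Otimes>\<^sub>M M :: (real \<times> real \<times> 'w) measure"
  define P where "P j k z = quiet (fst (snd z) - fst z) (fst (snd z)) j k (path (snd (snd z)))"
    for j k and z :: "real \<times> real \<times> 'w"
  have "{z\<in>space ?N. P j k z} \<in> sets ?N" if "j < n" for j k
    using measurable_compose[OF m measurable_quiet_path[OF that, of k]]
        by (simp add: pred_def P_def case_prod_beta)
  hence "{z\<in>space ?N. \<forall>k. P j k z} \<in> sets ?N" if "j \<in> {..<n}" for j
    using that by (intro sets.sets_Collect_countable_All) auto
  hence "{z\<in>space ?N. \<forall>j\<in>{..<n}. \<forall>k. P j k z} \<in> sets ?N"
    by (rule sets.sets_Collect_finite_All) auto
  moreover have "(\<lambda>(x, t, \<omega>). B x t \<omega>) = (\<lambda>z. \<forall>j\<in>{..<n}. \<forall>k. P j k z)"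
    by (auto simp: B_def P_def fun_eq_iff)
  ultimately show ?thesis by (simp only: pred_def)
qed

lemma prob_B2:
  assumes "0 \<le> x" "0 \<le> y" "y \<le> s" "s \<le> t - x"
  shows "prob {\<omega>\<in>space M. B x t \<omega> \<and> B y s \<omega>} = stale lam mu x ^ n * stale lam mu y ^ n"
proof -
  have "{\<omega>\<in>space M. B x t \<omega> \<and> B y s \<omega>} =
    {\<omega>\<in>space M. \<forall>j<n. \<forall>k. quiet (s - y) s j k (path \<omega>) \<and> quiet (t - x) t j k (path \<omega>)}"
    by (auto simp: B_def)
  thus ?thesis using prob_all_quiet[of "s - y" s "t - x" t] assms by (simp add: mult.commute)
qed

lemma events_B': "{\<omega>\<in>space M. B x t \<omega>} \<in> events"
proof -
  have "(\<lambda>\<omega>. (x, t, \<omega>)) \<in> M \<rightarrow>\<^sub>M borel \<Otimes>\<^sub>M borel \<Otimes>\<^sub>M M" by measurable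
  from measurable_compose[OF this pred_B] show ?thesis by simp
qed

text \<open>A second window of length 0 at time 0 is free: nonnegative service times make it quiet
  almost surely, and \<open>stale lam mu 0 = 1\<close>.\<close>

lemma prob_B1:
  assumes "0 \<le> x" "x \<le> t"
  shows "prob {\<omega>\<in>space M. B x t \<omega>} = stale lam mu x ^ n"
proof -
  have "prob {\<omega>\<in>space M. B x t \<omega>} = prob ({\<omega>\<in>space M. B x t \<omega>} \<inter> {\<omega>\<in>space M. B 0 0 \<omega>})"
  proof (rule finite_measure_eq_AE)
    show "AE \<omega> in M. \<omega> \<in> {\<omega>\<in>space M. B x t \<omega>} \<longleftrightarrow> \<omega> \<in> {\<omega>\<in>space M. B x t \<omega>} \<inter> {\<omega>\<in>space M. B 0 0 \<omega>}"
      using AE_S_nonneg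
    proof eventually_elim
      case (elim \<omega>)
      have "quiet 0 0 j k (path \<omega>)" if "j < n" for j k
        using elim[rule_format, OF that, of k] by (auto simp: quiet_def)
      thus ?case by (auto simp: B_def)
    qed
  qed (use events_B' in auto)
  also have "{\<omega>\<in>space M. B x t \<omega>} \<inter> {\<omega>\<in>space M. B 0 0 \<omega>} = {\<omega>\<in>space M. B x t \<omega> \<and> B 0 0 \<omega>}" by auto
  also have "prob \<dots> = stale lam mu x ^ n" using prob_B2[of x 0 0 t] assms by simp
  finally show ?thesis .
qed

text \<open>The age is at least \<open>x\<close> iff the supremum of the delivered generation times
  is at most \<open>t - x\<close>, that is, iff each of them is. The set is bounded by
  \<open>t\<close> because service times are nonnegative, and the inserted 0 yields
  \<open>a \<le> t\<close>.\<close>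

lemma age_bounds:
  assumes "\<forall>j<n. \<forall>k. S j k \<omega> \<ge> 0" "t \<ge> 0"
  defines "a \<equiv> age n (\<lambda>j k. A j k \<omega>) (\<lambda>j k. S j k \<omega>) t"
  shows "0 \<le> a" "a \<le> t" "x \<le> t \<Longrightarrow> x \<le> a \<longleftrightarrow> B x t \<omega>"
proof -
  let ?A = "\<lambda>j k. A j k \<omega>" and ?S = "\<lambda>j k. S j k \<omega>"
  define G where "G = {arr ?A j k | j k. j < n \<and> delivered ?A ?S j k \<and> arr ?A j k + ?S j k \<le> t}"
  have le: "g \<le> t" if "g \<in> G" for g
  proof -
    from that obtain j k where "j < n" "g = arr ?A j k" "arr ?A j k + ?S j k \<le>
        t" by (auto simp: G_def)
    moreover have "?S j k \<ge> 0" using assms(1) \<open>j < n\<close> by blast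
    ultimately show ?thesis by linarith
  qed
  have bdd: "bdd_above (insert 0 G)" using le by (auto intro!: bdd_aboveI[of _ t] simp: assms(2))
  have a: "a = t - Sup (insert 0 G)" by (simp add: a_def age_def latest_gen_def G_def)
  have "Sup (insert 0 G) \<le> t" using le assms(2) by (intro cSup_least) auto
  thus "0 \<le> a" by (simp add: a)
  have "0 \<le> Sup (insert 0 G)" using bdd by (intro cSup_upper) auto
  thus "a \<le> t" by (simp add: a)
  assume x: "x \<le> t"
  have "x \<le> a \<longleftrightarrow> Sup (insert 0 G) \<le> t - x" by (auto simp: a)
  also have "\<dots> \<longleftrightarrow> (\<forall>g\<in>insert 0 G. g \<le> t - x)" using bdd by (intro cSup_le_iff) auto
  \<comment> \<open>The inserted 0 satisfies the inequality because
    \<open>x \<le> t\<close>.\<close>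
  also have "\<dots> \<longleftrightarrow> (\<forall>g\<in>G. g \<le> t - x)" using x by auto
  also have "\<dots> \<longleftrightarrow> (\<forall>j<n. \<forall>k. delivered ?A ?S j k \<and> arr ?A j k + ?S j k \<le> t \<longrightarrow> arr ?A j k \<le> t - x)"
    unfolding G_def by blast
  also have "\<dots> \<longleftrightarrow> B x t \<omega>"
    unfolding B_def quiet_def arrivals_path services_path not_less[symmetric] by blast
  finally show "x \<le> a \<longleftrightarrow> B x t \<omega>" .
qed

lemma aoi_formula_nonneg: "aoi_formula n lam mu \<ge> 0"
proof (rule tendsto_lowerbound)
  show "((\<lambda>T. integral {0..T} (\<lambda>x. stale lam mu x ^ n)) \<longlongrightarrow> aoi_formula n lam mu) at_top"
    using n lam mu by (intro integral_stale_power_tendsto) auto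
  show "eventually (\<lambda>T. 0 \<le> integral {0..T} (\<lambda>x. stale lam mu x ^ n)) at_top"
    using lam by (intro always_eventually allI integral_nonneg integrable_continuous_interval
        continuous_intros)
      (auto simp: stale_nonneg)
qed auto

lemma AE_average_age:
  "AE \<omega> in M. ((\<lambda>T. (1 / T) * integral {0..T} (age n (\<lambda>j k. A j k \<omega>) (\<lambda>j k. S j k \<omega>)))
              \<longlongrightarrow> aoi_formula n lam mu) at_top"
proof -
  obtain C g where Cg: "C > 0" "g > 0" "\<And>x. x \<ge> 0 \<Longrightarrow> stale lam mu x \<le> C * exp (- g * x)"
    using stale_exp_bound[OF lam mu] by metis
  interpret fm: finite_memory M B "\<lambda>x. stale lam mu x ^ n" "C ^ n" "real n
      * g" "aoi_formula n lam mu"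
  proof
    show "0 \<le> C ^ n" "0 < real n * g" using Cg n by auto
    show "0 \<le> aoi_formula n lam mu" by (rule aoi_formula_nonneg)
    show "0 \<le> stale lam mu x ^ n" if "0 \<le> x" for x using stale_nonneg[OF lam that] by simp
    show "stale lam mu x ^ n \<le> C ^ n * exp (- (real n * g) * x)" if "0 \<le> x" for x
    proof -
      have "stale lam mu x ^ n \<le> (C * exp (- g * x)) ^ n"
        using Cg(3)[OF that] stale_nonneg[OF lam that] by (intro power_mono)
      also have "\<dots> = C ^ n * exp (- (real n * g) * x)"
        by (simp add: power_mult_distrib exp_of_nat_mult[symmetric] mult_ac)
      finally show ?thesis .
    qed
    show "(\<integral>\<^sup>+x. ennreal (stale lam mu x ^ n) * indicator {0..} x \<partial>lborel) =
        ennreal (aoi_formula n lam mu)"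
      using n lam mu by (intro nn_integral_stale_power) auto
  qed (auto intro: pred_B prob_B1 prob_B2)
  have eq: "integral {0..T} (age n (\<lambda>j k. A j k \<omega>) (\<lambda>j k. S j k \<omega>)) = fm.rvol T \<omega>"
    if S: "\<forall>j<n. \<forall>k. S j k \<omega> \<ge> 0" and \<omega>: "\<omega> \<in> space M" and T: "T \<ge> 0" for T \<omega>
  proof -
    let ?a = "age n (\<lambda>j k. A j k \<omega>) (\<lambda>j k. S j k \<omega>)"
    let ?R = "region B T \<omega>"
    define f where "f t = (if t \<in> {0..T} then ?a t else 0)" for t
    have f0: "f t \<ge> 0" for t using age_bounds(1)[OF S] by (simp add: f_def)
    have R: "?R \<in> sets (lborel \<Otimes>\<^sub>M lborel)" by (rule fm.sets_region[OF \<omega>])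
    \<comment> \<open>Layer-cake identity: by \<open>age_bounds\<close> the section of the region at
      a time \<open>t\<close> in \<open>{0..T}\<close> is \<open>{0..?a t}\<close>, whose length is
      the age.\<close>
    have sec: "emeasure lborel ((\<lambda>x. (x, t)) -` ?R) = ennreal (f t)" for t
    proof (cases "t \<in> {0..T}")
      case True
      hence "(\<lambda>x. (x, t)) -` ?R = {0..?a t}"
        using age_bounds(2)[OF S, of t] age_bounds(3)[OF S, of t]
        by (auto simp: region_def) (metis order_trans)
      thus ?thesis using True age_bounds(1)[OF S, of t] by (simp add: f_def)
    next
      case False
      hence "(\<lambda>x. (x, t)) -` ?R = {}" by (auto simp: region_def)
      thus ?thesis using False by (auto simp: f_def)
    qed
    have vol: "fm.vol T \<omega> = (\<integral>\<^sup>+t. ennreal (f t) \<partial>lborel)"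
      unfolding fm.vol_def by (subst lborel_pair.emeasure_pair_measure_alt2[OF R]) (simp add: sec)
    \<comment> \<open>Measurability of the age in \<open>t\<close> is inherited from the section
      lengths of a measurable set.\<close>
    have "(\<lambda>t. emeasure lborel ((\<lambda>x. (x, t)) -` ?R)) \<in> borel_measurable lborel"
      by (rule lborel_pair.measurable_emeasure_Pair2[OF R])
    hence "(\<lambda>t. enn2real (ennreal (f t))) \<in> borel_measurable borel" unfolding sec by measurable
    hence "f \<in> borel_measurable borel" by (simp add: f0)
    hence "(f has_integral fm.rvol T \<omega>) UNIV"
      using f0 vol fm.ennreal_rvol[OF T, of \<omega>] fm.rvol_nonneg[of T \<omega>]
          by (intro nn_integral_has_integral) auto
    hence "(?a has_integral fm.rvol T \<omega>) {0..T}"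
      unfolding f_def by (subst (asm) has_integral_restrict_UNIV)
    thus ?thesis by (rule integral_unique)
  qed
  show ?thesis
    using fm.AE_rvol_tendsto AE_S_nonneg AE_space
  proof eventually_elim
    case (elim \<omega>)
    have "eventually (\<lambda>T. fm.rvol T \<omega> / T = (1 / T)
        * integral {0..T} (age n (\<lambda>j k. A j k \<omega>) (\<lambda>j k. S j k \<omega>))) at_top"
      using eventually_ge_at_top[of 0] by eventually_elim (use eq elim in simp)
    from tendsto_cong[OF this] elim(1) show ?case by simp
  qed
qed

end

theorem theorem1:
  fixes M :: "'w measure" and n :: nat and lam mu :: real
    and A S :: "nat \<Rightarrow> nat \<Rightarrow> 'w \<Rightarrow> real"
  assumes "prob_space M"
    and "n \<ge> 1" and "lam > 0" and "mu > 0"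
    and "\<And>j k. j < n \<Longrightarrow> distributed M lborel (A j k) (exponential_density lam)"
    and "\<And>j k. j < n \<Longrightarrow> distributed M lborel (S j k) (exponential_density mu)"
    and "prob_space.indep_vars M (\<lambda>_. borel)
           (\<lambda>(b, j, k). if b then A j k else S j k) {(b, j, k). j < n}"
  shows "AE \<omega> in M.
           ((\<lambda>T. (1 / T) * integral {0..T} (age n (\<lambda>j k. A j k \<omega>) (\<lambda>j k. S j k \<omega>)))
              \<longlongrightarrow> aoi_formula n lam mu) at_top"
proof -
  interpret prob_space M by fact
  interpret lcfs_network M n lam mu A S
    by unfold_locales (use assms in auto)
  show ?thesis by (rule AE_average_age)
qed

end
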